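(* Fix $T>0$. For integers $n,m\ge 2$, let $\mathcal H_{\mathbb P}(n,m)\in\mathbb N\cup\{+\infty\}$ be the supremum of the number of limit cycles of the Abel equation $$\frac{dx}{dt}=A(t)x^3+B(t)x^2,\qquad t\in[-T,T],$$ over all real polynomials $A(t)=\sum_{i=0}^na_it^i$ and $B(t)=\sum_{j=0}^mb_jt^j$. Then $$\mathcal H_{\mathbb P}(n,m)\ \ge\ 2\left(m-\left[\frac m2\right]+\left[\frac n2\right]\right)-1,$$ where $[\cdot]$ denotes the integer part.
   Context: A closed solution of the equation is a solution defined on all of $[-T,T]$ with $x(-T)=x(T)$; a limit cycle is a closed solution that is isolated among closed solutions (i.e. its initial value $x(-T)$ is isolated in the set of initial values of closed solutions). The solution $x\equiv0$ is counted if isolated. *)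

theory Defs
  imports "HOL-Analysis.Analysis" "HOL-Computational_Algebra.Polynomial"
    "HOL-Library.Extended_Nat" "HOL-Library.FuncSet"
begin

text \<open>
  Solutions are functions on the closed interval \<open>{-T..T}\<close> (with one-sided derivatives at the
  endpoints).  They are taken in \<^term>\<open>extensional {-T..T}\<close>, so that two solutions are equal
  iff they agree on the interval and can be counted.
\<close>

definition abel_solution :: "real \<Rightarrow> real poly \<Rightarrow> real poly \<Rightarrow> (real \<Rightarrow> real) \<Rightarrow> bool" where
  "abel_solution T A B x \<longleftrightarrow>
     x \<in> extensional {-T..T} \<and>
     (\<forall>t\<in>{-T..T}.
        (x has_real_derivative (poly A t * x t ^ 3 + poly B t * x t ^ 2)) (at t within {-T..T}))"

definition closed_solutions :: "real \<Rightarrow> real poly \<Rightarrow> real poly \<Rightarrow> (real \<Rightarrow> real) set" where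
  "closed_solutions T A B = {x. abel_solution T A B x \<and> x (-T) = x T}"

definition limit_cycles :: "real \<Rightarrow> real poly \<Rightarrow> real poly \<Rightarrow> (real \<Rightarrow> real) set" where
  "limit_cycles T A B =
     {x \<in> closed_solutions T A B. x (-T) isolated_in ((\<lambda>y. y (-T)) ` closed_solutions T A B)}"

text \<open>Unlike \<^const>\<open>card\<close>, this sends infinite sets to \<open>\<infinity>\<close>.\<close>

definition ecard :: "'a set \<Rightarrow> enat" where
  "ecard S = (if finite S then enat (card S) else \<infinity>)"

text \<open>
  The degrees are only bounded by \<open>n\<close> and \<open>m\<close>: leading coefficients may vanish.
\<close>

definition abel_hilbert_number :: "real \<Rightarrow> nat \<Rightarrow> nat \<Rightarrow> enat" where
  "abel_hilbert_number T n m =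
     (SUP (A, B) \<in> {(A, B). degree A \<le> n \<and> degree B \<le> m}. ecard (limit_cycles T A B))"

end

theory Submission
  imports Defs "HOL-Complex_Analysis.Complex_Analysis"
    "HOL-Computational_Algebra.Fundamental_Theorem_Algebra"
begin

text \<open>
  Perturb the center \<open>x' = t x\<^sup>3\<close>: take \<open>A = t + \<epsilon> a\<close> with \<open>\<integral>a = 0\<close> and \<open>B = \<delta> (b + \<epsilon> \<beta>)\<close> with \<open>b\<close>
  odd.  For \<open>B = 0\<close> every solution is closed, with \<open>1 / x\<^sup>2 = 1 / r\<^sup>2 - 2 \<integral>A\<close>.  To first order in \<open>\<delta>\<close> and
  then in \<open>\<epsilon>\<close>, the sign of the displacement at \<open>r\<close> is that of an explicit function \<open>G(z)\<close> of
  \<open>z = r\<^sup>2\<close>; so every change of sign of \<open>G\<close> gives one positive and one negative closed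
  solution.  With \<open>w = T\<^sup>2 - t\<^sup>2\<close>, \<open>b = t p\<^sub>1(w)\<close> and \<open>\<integral>a = - t w p\<^sub>2(w)\<close>,
  \<open>G(z) = \<beta> \<integral> \<surd>(1 + z w) + z \<integral> t\<^sup>2 w p(w) / \<surd>(1 + z w)\<close> where \<open>p = p\<^sub>1 p\<^sub>2\<close>.  Inserting the orthogonal
  polynomials for the weight \<open>t\<^sup>2 w dt\<close> one obtains functions of exact order \<open>z\<^sup>k\<close> at \<open>0\<close>, and a suitable
  combination of them changes sign \<open>deg p + 1\<close> times near \<open>0\<close>.

  All cycles lie in a disc of initial values on which the solution is holomorphic in \<open>r\<close>;
  therefore closed solutions are isolated.
\<close>

section \<open>Small solutions\<close>

text \<open>The degrees \<open>2 deg p1 + 1 \<le> m\<close> of \<open>b\<close> and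
  \<open>2 deg p2 + 2 \<le> n\<close> of \<open>a\<close> fix the count: with K = deg p + 1 sign
  changes there are K cycles on each side of 0, and \<open>x = 0\<close> is one more. Since
  \<open>b\<close> is odd, the term of order \<epsilon>^0 vanishes and \<open>G\<close> is the
  leading one; since the integral of \<open>a\<close> is odd too, its product with \<open>b\<close>
  is even and does not cancel. The constant \<beta> supplies the one function that does not vanish
  at \<open>z = 0\<close>. The obstacle: the sign-change construction delivers \<open>p\<close> as a
  whole, which must afterwards be split into real factors of prescribed degrees. This can fail only
  if both degrees are odd and \<open>p\<close> has no real root. Then, however, \<open>p\<close> has
  constant sign, and a monotonicity argument shows that \<open>G\<close> cannot change sign twice.
  The radius \<rho> of the disc depends on \<open>T\<close> alone, so it is fixed before the sample
  points \<open>z i\<close> are placed below \<rho>^2. Only finitely many signs have to survive, so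
  a small \<epsilon> can be fixed, and then a small \<delta>.\<close>

definition antiderivative :: "complex \<Rightarrow> complex poly \<Rightarrow> complex poly" where
  "antiderivative a q =
     (let I = (\<Sum>i\<le>degree q. monom (coeff q i / of_nat (Suc i)) (Suc i)) in I - [:poly I a:])"

lemma coeff_antiderivative_Suc: "coeff (antiderivative a q) (Suc i) = coeff q i / of_nat (Suc i)"
  by (simp add: antiderivative_def Let_def coeff_sum coeff_eq_0 del: of_nat_Suc)

lemma pderiv_antiderivative: "pderiv (antiderivative a q) = q"
  by (rule poly_eqI) (simp add: coeff_pderiv coeff_antiderivative_Suc del: of_nat_Suc)

lemma poly_antiderivative_base: "poly (antiderivative a q) a = 0"
  by (simp add: antiderivative_def Let_def)

lemma antiderivative_degree: "degree (antiderivative a q) \<le> Suc (degree q)"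
  unfolding antiderivative_def Let_def
  by (intro degree_diff_le degree_sum_le) (auto intro: order.trans[OF degree_monom_le])

lemma coeff_antiderivative_0:
  assumes "degree q \<le> N"
  shows "coeff (antiderivative a q) 0 = - (\<Sum>i\<le>N. coeff q i / of_nat (Suc i) * a ^ Suc i)"
proof -
  have "coeff (antiderivative a q) 0 =
      - (\<Sum>i\<le>degree q. coeff q i / of_nat (Suc i) * a ^ Suc i)"
    by (simp add: antiderivative_def Let_def coeff_sum poly_sum poly_monom del: of_nat_Suc)
  also have "(\<Sum>i\<le>degree q. coeff q i / of_nat (Suc i) * a ^ Suc i) =
        (\<Sum>i\<le>N. coeff q i / of_nat (Suc i) * a ^ Suc i)"
    using assms by (intro sum.mono_neutral_left) (auto simp: coeff_eq_0)
  finally show ?thesis .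
qed

text \<open>The degree bound uniform in \<open>r\<close> makes evaluation at a fixed
  \<open>t\<close> one finite sum for all \<open>r\<close>, hence holomorphic in \<open>r\<close>.
  Picard iterates stay in this class because integration in \<open>t\<close> acts on the
  coefficients only.\<close>

definition holomorphic_coeffs :: "(complex \<Rightarrow> complex poly) \<Rightarrow> bool" where
  "holomorphic_coeffs Y \<longleftrightarrow>
     (\<exists>N. \<forall>r. degree (Y r) \<le> N) \<and> (\<forall>i. (\<lambda>r. coeff (Y r) i) holomorphic_on UNIV)"

lemma holomorphic_coeffs_const: "holomorphic_coeffs (\<lambda>r. p)"
  by (auto simp: holomorphic_coeffs_def)

lemma holomorphic_coeffs_pCons: "holomorphic_coeffs (\<lambda>r. [:r:])"
  unfolding holomorphic_coeffs_def
proof safe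
  show "\<exists>N. \<forall>r::complex. degree [:r:] \<le> N" by auto
  show "(\<lambda>r::complex. coeff [:r:] i) holomorphic_on UNIV" for i
    by (cases i) auto
qed

lemma holomorphic_coeffs_add:
  assumes "holomorphic_coeffs Y" "holomorphic_coeffs Z"
  shows "holomorphic_coeffs (\<lambda>r. Y r + Z r)"
proof -
  from assms obtain M N where "\<And>r. degree (Y r) \<le> M" "\<And>r. degree (Z r) \<le> N"
    by (auto simp: holomorphic_coeffs_def)
  then have "degree (Y r + Z r) \<le> max M N" for r
    by (meson degree_add_le max.cobounded1 max.cobounded2 order_trans)
  with assms show ?thesis
    by (auto simp: holomorphic_coeffs_def intro!: holomorphic_intros)
qed

lemma holomorphic_coeffs_mult:
  assumes "holomorphic_coeffs Y" "holomorphic_coeffs Z"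
  shows "holomorphic_coeffs (\<lambda>r. Y r * Z r)"
proof -
  from assms obtain M N where "\<And>r. degree (Y r) \<le> M" "\<And>r. degree (Z r) \<le> N"
    by (auto simp: holomorphic_coeffs_def)
  then have "degree (Y r * Z r) \<le> M + N" for r
    by (meson add_mono degree_mult_le order_trans)
  with assms show ?thesis
    by (auto simp: holomorphic_coeffs_def coeff_mult intro!: holomorphic_intros)
qed

lemma holomorphic_coeffs_power:
  "holomorphic_coeffs Y \<Longrightarrow> holomorphic_coeffs (\<lambda>r. Y r ^ k)"
  by (induction k) (auto intro: holomorphic_coeffs_const holomorphic_coeffs_mult)

lemma holomorphic_coeffs_antiderivative:
  assumes "holomorphic_coeffs Y"
  shows "holomorphic_coeffs (\<lambda>r. antiderivative a (Y r))"
proof -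
  from assms obtain N where N: "\<And>r. degree (Y r) \<le> N"
    and hol: "\<And>i. (\<lambda>r. coeff (Y r) i) holomorphic_on UNIV"
    by (auto simp: holomorphic_coeffs_def)
  have deg: "degree (antiderivative a (Y r)) \<le> Suc N" for r
    using antiderivative_degree[of a "Y r"] N[of r] by linarith
  have "(\<lambda>r. coeff (antiderivative a (Y r)) i) holomorphic_on UNIV" for i
  proof (cases i)
    case 0
    show ?thesis
      unfolding 0 coeff_antiderivative_0[OF N] by (intro holomorphic_intros hol) simp
  next
    case (Suc j)
    show ?thesis
      unfolding Suc coeff_antiderivative_Suc by (intro holomorphic_intros hol) simp
  qed
  with deg show ?thesis
    by (auto simp: holomorphic_coeffs_def)
qed

lemma holomorphic_coeffs_poly:
  assumes "holomorphic_coeffs Y"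
  shows "(\<lambda>r. poly (Y r) t) holomorphic_on UNIV"
proof -
  from assms obtain N where N: "\<And>r. degree (Y r) \<le> N"
    and hol: "\<And>i. (\<lambda>r. coeff (Y r) i) holomorphic_on UNIV"
    by (auto simp: holomorphic_coeffs_def)
  have "poly (Y r) t = (\<Sum>i\<le>N. coeff (Y r) i * t ^ i)" for r
    unfolding poly_altdef using N[of r]
    by (intro sum.mono_neutral_left) (auto simp: coeff_eq_0)
  then show ?thesis
    by (auto intro!: holomorphic_intros hol)
qed

lemma poly_of_real_vector_derivative:
  "((\<lambda>s. poly q (complex_of_real s)) has_vector_derivative poly (pderiv q) (of_real t)) (at t within S)"
  by (rule has_vector_derivative_real_field) (rule poly_DERIV)

lemma complex_poly_of_real: "poly (map_poly complex_of_real p) (of_real t) = of_real (poly p t)"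
  by (induction p) (auto simp: map_poly_pCons)

definition real_coeffs :: "complex poly \<Rightarrow> bool" where
  "real_coeffs p \<longleftrightarrow> (\<forall>i. coeff p i \<in> \<real>)"

lemma real_coeffs_map_poly: "real_coeffs (map_poly of_real p)"
  by (auto simp: real_coeffs_def coeff_map_poly)

lemma real_coeffs_add: "real_coeffs p \<Longrightarrow> real_coeffs q \<Longrightarrow> real_coeffs (p + q)"
  by (auto simp: real_coeffs_def)

lemma real_coeffs_mult: "real_coeffs p \<Longrightarrow> real_coeffs q \<Longrightarrow> real_coeffs (p * q)"
  by (auto simp: real_coeffs_def coeff_mult)

lemma real_coeffs_power: "real_coeffs p \<Longrightarrow> real_coeffs (p ^ k)"
proof (induction k)
  case 0
  then show ?case by (simp add: real_coeffs_def)
next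
  case (Suc k)
  then show ?case by (simp add: real_coeffs_mult)
qed

lemma real_coeffs_antiderivative:
  assumes "a \<in> \<real>" "real_coeffs p"
  shows "real_coeffs (antiderivative a p)"
  unfolding real_coeffs_def
proof
  fix i
  show "coeff (antiderivative a p) i \<in> \<real>"
  proof (cases i)
    case 0
    show ?thesis
      unfolding 0 coeff_antiderivative_0[OF order.refl] using assms
      by (intro Reals_minus sum_in_Reals Reals_mult Reals_divide Reals_power)
        (auto simp: real_coeffs_def)
  next
    case (Suc j)
    show ?thesis
      unfolding Suc coeff_antiderivative_Suc using assms
      by (intro Reals_divide) (auto simp: real_coeffs_def)
  qed
qed

lemma real_coeffs_poly: "real_coeffs p \<Longrightarrow> t \<in> \<real> \<Longrightarrow> poly p t \<in> \<real>"
  by (auto simp: real_coeffs_def poly_altdef intro!: sum_in_Reals Reals_mult Reals_power)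

section \<open>Picard iteration with complex initial values\<close>

lemma vector_derivative_lipschitz:
  fixes f :: "real \<Rightarrow> 'a::real_normed_vector"
  assumes "convex S"
    and "\<And>t. t \<in> S \<Longrightarrow> (f has_vector_derivative f' t) (at t within S)"
    and "\<And>t. t \<in> S \<Longrightarrow> norm (f' t) \<le> L"
    and "s \<in> S" "t \<in> S"
  shows "norm (f s - f t) \<le> L * \<bar>s - t\<bar>"
proof -
  have "norm (f s - f t) \<le> L * norm (s - t)"
  proof (rule differentiable_bound[OF assms(1) _ _ assms(4,5)])
    fix u assume u: "u \<in> S"
    show "(f has_derivative (\<lambda>h. h *\<^sub>R f' u)) (at u within S)"
      using assms(2)[OF u] by (simp add: has_vector_derivative_def)
    show "onorm (\<lambda>h. h *\<^sub>R f' u) \<le> L"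
      using assms(3)[OF u] order.trans[OF norm_ge_zero assms(3)[OF u]]
      by (intro onorm_bound) (auto simp: mult.commute[of L] intro!: mult_left_mono)
  qed
  then show ?thesis by simp
qed

text \<open>The constant 64 makes each Picard step halve the distance: the Lipschitz bound
  \<open>16 * M * \<rho>\<close> over a time of at most \<open>2 * T\<close> gives
  \<open>32 * T * M * \<rho> \<le> 1 / 2\<close>. It also covers the factor
  \<open>24 * T * M * \<rho>\<close> by which iterates can leave the initial value.\<close>

locale picard =
  fixes T M \<rho> :: real and A B :: "real poly"
  assumes T_pos: "0 < T" and M_pos: "0 < M" and rho_pos: "0 < \<rho>" and rho_le: "\<rho> \<le> 1"
    and rho_small: "64 * T * M * \<rho> \<le> 1"
    and A_bound: "\<And>t. t \<in> {-T..T} \<Longrightarrow> \<bar>poly A t\<bar> \<le> M"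
    and B_bound: "\<And>t. t \<in> {-T..T} \<Longrightarrow> \<bar>poly B t\<bar> \<le> M"
begin

definition rhs :: "real \<Rightarrow> complex \<Rightarrow> complex" where
  "rhs t x = of_real (poly A t) * x ^ 3 + of_real (poly B t) * x ^ 2"

text \<open>Applied with \<open>s = norm r\<close>. The bound is linear in \<open>s\<close>, so the
  deviation of an iterate from \<open>r\<close> is proportional to \<open>norm r\<close> and not
  merely to \<rho>.\<close>

lemma norm_rhs_le:
  assumes t: "t \<in> {-T..T}" and s: "s \<le> \<rho>" and x: "norm x \<le> 2 * s"
  shows "norm (rhs t x) \<le> 12 * M * \<rho> * s"
proof -
  have s0: "0 \<le> s" using x norm_ge_zero[of x] by linarith
  have "norm (rhs t x) \<le> M * (2 * s) ^ 3 + M * (2 * s) ^ 2"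
    unfolding rhs_def using A_bound[OF t] B_bound[OF t] M_pos x s0
    by (intro norm_triangle_mono; unfold norm_mult norm_power norm_of_real)
      (intro mult_mono power_mono; simp)+
  also have "\<dots> = M * s * (8 * (s * s) + 4 * s)"
    by (simp add: power2_eq_square power3_eq_cube algebra_simps)
  also have "\<dots> \<le> M * s * (12 * \<rho>)"
  proof (rule mult_left_mono)
    have "s * s \<le> 1 * \<rho>" using s s0 rho_le by (intro mult_mono) auto
    then show "8 * (s * s) + 4 * s \<le> 12 * \<rho>" using s by linarith
  qed (use s0 M_pos in auto)
  finally show ?thesis by (simp add: algebra_simps)
qed

lemma rhs_lipschitz:
  assumes t: "t \<in> {-T..T}" and s: "s \<le> \<rho>" and x: "norm x \<le> 2 * s" and y: "norm y \<le> 2 * s"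
  shows "norm (rhs t x - rhs t y) \<le> 16 * M * \<rho> * norm (x - y)"
proof -
  have s0: "0 \<le> s" using x norm_ge_zero[of x] by linarith
  have eq: "rhs t x - rhs t y =
      (of_real (poly A t) * (x * x + x * y + y * y) + of_real (poly B t) * (x + y)) * (x - y)"
    by (simp add: rhs_def power2_eq_square power3_eq_cube algebra_simps)
  have quad: "norm (x * x + x * y + y * y) \<le> 12 * (s * s)"
  proof -
    have "norm (x * x + x * y + y * y) \<le> (2 * s) * (2 * s) + (2 * s) * (2 * s) + (2 * s) * (2 * s)"
      by (intro norm_triangle_mono; unfold norm_mult; intro mult_mono x y) (use s0 in auto)
    then show ?thesis by simp
  qed
  have lin: "norm (x + y) \<le> 2 * s + 2 * s"
    using x y by (intro norm_triangle_mono)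
  have "norm (of_real (poly A t) * (x * x + x * y + y * y) + of_real (poly B t) * (x + y))
      \<le> M * (12 * (s * s)) + M * (2 * s + 2 * s)"
    using A_bound[OF t] B_bound[OF t] M_pos
    by (intro norm_triangle_mono)
      (auto simp: norm_mult intro!: mult_mono order.trans[OF quad] order.trans[OF lin])
  also have "\<dots> = M * (12 * (s * s) + 4 * s)"
    by (simp add: algebra_simps)
  also have "\<dots> \<le> M * (16 * \<rho>)"
  proof (rule mult_left_mono)
    have "s * s \<le> 1 * \<rho>" using s s0 rho_le by (intro mult_mono) auto
    then show "12 * (s * s) + 4 * s \<le> 16 * \<rho>" using s by linarith
  qed (use M_pos in auto)
  finally have "norm (of_real (poly A t) * (x * x + x * y + y * y) + of_real (poly B t) * (x + y))
      \<le> 16 * M * \<rho>" by (simp add: algebra_simps)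
  then show ?thesis
    unfolding eq norm_mult by (intro mult_right_mono) auto
qed

primrec iter_poly :: "nat \<Rightarrow> complex \<Rightarrow> complex poly" where
  "iter_poly 0 r = [:r:]"
| "iter_poly (Suc k) r = [:r:] + antiderivative (- of_real T)
     (map_poly of_real A * iter_poly k r ^ 3 + map_poly of_real B * iter_poly k r ^ 2)"

definition iterate :: "nat \<Rightarrow> complex \<Rightarrow> real \<Rightarrow> complex" where
  "iterate k r t = poly (iter_poly k r) (of_real t)"

lemma iterate_0: "iterate 0 r t = r"
  by (simp add: iterate_def)

lemma iterate_base: "iterate k r (-T) = r"
  by (cases k) (simp_all add: iterate_def poly_antiderivative_base)

lemma iterate_holomorphic: "(\<lambda>r. iterate k r t) holomorphic_on UNIV"
proof -
  have "holomorphic_coeffs (iter_poly k)"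
  proof (induction k)
    case 0
    then show ?case by (simp add: holomorphic_coeffs_pCons)
  next
    case (Suc k)
    then show ?case
      by (auto intro!: holomorphic_coeffs_add holomorphic_coeffs_pCons
          holomorphic_coeffs_antiderivative holomorphic_coeffs_mult holomorphic_coeffs_power
          holomorphic_coeffs_const)
  qed
  then show ?thesis
    unfolding iterate_def by (rule holomorphic_coeffs_poly)
qed

lemma iterate_real:
  assumes "r \<in> \<real>"
  shows "iterate k r t \<in> \<real>"
proof -
  have pconst: "real_coeffs [:r:]"
    using assms by (auto simp: real_coeffs_def coeff_pCons split: nat.split)
  have "real_coeffs (iter_poly k r)"
    by (induction k) (auto intro!: pconst real_coeffs_add real_coeffs_antiderivative
        real_coeffs_mult real_coeffs_power real_coeffs_map_poly)
  then show ?thesis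
    unfolding iterate_def by (rule real_coeffs_poly) auto
qed

lemma iterate_vector_derivative:
  "(iterate (Suc k) r has_vector_derivative rhs t (iterate k r t)) (at t within S)"
proof -
  have "poly (pderiv (iter_poly (Suc k) r)) (of_real t) = rhs t (iterate k r t)"
    by (simp add: pderiv_add pderiv_pCons pderiv_antiderivative rhs_def iterate_def
        complex_poly_of_real)
  then show ?thesis
    using poly_of_real_vector_derivative[of "iter_poly (Suc k) r" t S]
    by (simp add: iterate_def[abs_def])
qed

lemma interval_contains: "t \<in> {-T..T} \<Longrightarrow> \<bar>t - - T\<bar> \<le> 2 * T"
  by auto

text \<open>The bound is relative to \<open>norm r\<close>. Passed on to the real flow, it keeps a
  solution starting at \<open>r \<noteq> 0\<close> on one side of 0, where \<open>1 / x^2\<close> is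
  a legitimate coordinate.\<close>

lemma iterate_near:
  assumes r: "norm r \<le> \<rho>" and t: "t \<in> {-T..T}"
  shows "norm (iterate k r t - r) \<le> norm r / 2"
  using t
proof (induction k arbitrary: t)
  case 0
  then show ?case by (simp add: iterate_0)
next
  case (Suc k)
  have "norm (rhs u (iterate k r u)) \<le> 12 * M * \<rho> * norm r" if u: "u \<in> {-T..T}" for u
    using Suc.IH[OF u] norm_triangle_sub[of "iterate k r u" r] norm_ge_zero[of r]
    by (intro norm_rhs_le[OF u r]) linarith
  then have "norm (iterate (Suc k) r t - iterate (Suc k) r (-T)) \<le> 12 * M * \<rho> * norm r * \<bar>t - - T\<bar>"
    using Suc.prems T_pos
    by (intro vector_derivative_lipschitz[of "{-T..T}" _ "\<lambda>u. rhs u (iterate k r u)"]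
        iterate_vector_derivative) auto
  also have "\<dots> \<le> 12 * M * \<rho> * norm r * (2 * T)"
    using interval_contains[OF Suc.prems] M_pos rho_pos by (intro mult_left_mono) auto
  also have "\<dots> = (24 * T * M * \<rho>) * norm r" by simp
  also have "\<dots> \<le> 1 / 2 * norm r"
    using rho_small by (intro mult_right_mono) auto
  finally show ?case by (simp add: iterate_base)
qed

lemma norm_iterate_le:
  assumes "norm r \<le> \<rho>" "t \<in> {-T..T}"
  shows "norm (iterate k r t) \<le> 2 * norm r"
  using iterate_near[OF assms, of k] norm_triangle_sub[of "iterate k r t" r] norm_ge_zero[of r]
  by linarith

lemma iterate_diff:
  assumes r: "norm r \<le> \<rho>" and t: "t \<in> {-T..T}"
  shows "norm (iterate (Suc k) r t - iterate k r t) \<le> (1 / 2) ^ k"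
  using t
proof (induction k arbitrary: t)
  case 0
  then show ?case using iterate_near[OF r 0, of "Suc 0"] r rho_le
    by (simp add: iterate_0)
next
  case (Suc k)
  define g where "g u = iterate (Suc (Suc k)) r u - iterate (Suc k) r u" for u
  have der: "(g has_vector_derivative rhs u (iterate (Suc k) r u) - rhs u (iterate k r u))
      (at u within {-T..T})" for u
    unfolding g_def[abs_def]
    by (intro has_vector_derivative_diff iterate_vector_derivative)
  have "norm (rhs u (iterate (Suc k) r u) - rhs u (iterate k r u)) \<le> 16 * M * \<rho> * (1 / 2) ^ k"
    if u: "u \<in> {-T..T}" for u
  proof -
    have "norm (rhs u (iterate (Suc k) r u) - rhs u (iterate k r u)) \<le>
        16 * M * \<rho> * norm (iterate (Suc k) r u - iterate k r u)"
      by (intro rhs_lipschitz[OF u r] norm_iterate_le r u)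
    also have "\<dots> \<le> 16 * M * \<rho> * (1 / 2) ^ k"
      using Suc.IH[OF u] M_pos rho_pos by (intro mult_left_mono) auto
    finally show ?thesis .
  qed
  then have "norm (g t - g (-T)) \<le> 16 * M * \<rho> * (1 / 2) ^ k * \<bar>t - - T\<bar>"
    using Suc.prems T_pos
    by (intro vector_derivative_lipschitz[OF _ der]) auto
  also have "\<dots> \<le> 16 * M * \<rho> * (1 / 2) ^ k * (2 * T)"
    using interval_contains[OF Suc.prems] M_pos rho_pos by (intro mult_left_mono) auto
  also have "\<dots> = (32 * T * M * \<rho>) * (1 / 2) ^ k" by simp
  also have "\<dots> \<le> 1 / 2 * (1 / 2) ^ k"
    using rho_small by (intro mult_right_mono) auto
  finally show ?case by (simp add: g_def iterate_base)
qed

text \<open>The limit of the iterates, written as a telescoping series: the geometric bound on the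
  increments then yields convergence uniform in \<open>r\<close> and \<open>t\<close> jointly by the
  Weierstrass test.\<close>

definition sol :: "complex \<Rightarrow> real \<Rightarrow> complex" where
  "sol r t = r + (\<Sum>k. iterate (Suc k) r t - iterate k r t)"

lemma iterate_uniform_limit:
  "uniform_limit (cball 0 \<rho> \<times> {-T..T}) (\<lambda>n (r, t). iterate n r t) (\<lambda>(r, t). sol r t) sequentially"
proof -
  define f where "f k = (\<lambda>(r, t). iterate (Suc k) r t - iterate k r t)" for k
  have "uniform_limit (cball 0 \<rho> \<times> {-T..T}) (\<lambda>n x. \<Sum>i<n. f i x) (\<lambda>x. \<Sum>i. f i x) sequentially"
    by (rule Weierstrass_m_test[where M = "\<lambda>k. (1 / 2) ^ k"])
      (auto simp: f_def iterate_diff intro!: summable_geometric)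
  then have "uniform_limit (cball 0 \<rho> \<times> {-T..T}) (\<lambda>n x. fst x + (\<Sum>i<n. f i x))
      (\<lambda>x. fst x + (\<Sum>i. f i x)) sequentially"
    by (intro uniform_limit_add uniform_limit_const)
  moreover have "fst x + (\<Sum>i<n. f i x) = (case x of (r, t) \<Rightarrow> iterate n r t)" for n x
    using sum_lessThan_telescope[of "\<lambda>i. iterate i (fst x) (snd x)" n]
    by (cases x) (simp add: f_def iterate_0)
  moreover have "fst x + (\<Sum>i. f i x) = (case x of (r, t) \<Rightarrow> sol r t)" for x
    by (simp add: f_def sol_def split: prod.splits)
  ultimately show ?thesis by simp
qed

lemma iterate_tendsto:
  assumes "norm r \<le> \<rho>" "t \<in> {-T..T}"
  shows "(\<lambda>n. iterate n r t) \<longlonglongrightarrow> sol r t"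
  using tendsto_uniform_limitI[OF iterate_uniform_limit, of "(r, t)"] assms by simp

lemma sol_base: "norm r \<le> \<rho> \<Longrightarrow> sol r (-T) = r"
  using iterate_tendsto[of r "-T"] T_pos LIMSEQ_unique[OF tendsto_const]
  by (fastforce simp: iterate_base)

lemma sol_near:
  assumes "norm r \<le> \<rho>" "t \<in> {-T..T}"
  shows "norm (sol r t - r) \<le> norm r / 2"
proof (rule tendsto_upperbound)
  show "(\<lambda>n. norm (iterate n r t - r)) \<longlonglongrightarrow> norm (sol r t - r)"
    by (intro tendsto_intros iterate_tendsto assms)
  show "\<forall>\<^sub>F n in sequentially. norm (iterate n r t - r) \<le> norm r / 2"
    by (intro always_eventually allI iterate_near assms)
qed simp

lemma sol_real:
  assumes "r \<in> \<real>" "norm r \<le> \<rho>" "t \<in> {-T..T}"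
  shows "sol r t \<in> \<real>"
  using Lim_in_closed_set[OF closed_complex_Reals _ _ iterate_tendsto[OF assms(2,3)]]
    iterate_real[OF assms(1)] by (auto intro: always_eventually)

text \<open>For fixed \<open>t\<close> the iterates are entire in \<open>r\<close> and converge
  locally uniformly on the disc.\<close>

lemma sol_holomorphic:
  assumes t: "t \<in> {-T..T}"
  shows "(\<lambda>r. sol r t) holomorphic_on ball 0 \<rho>"
proof (rule holomorphic_uniform_sequence[OF open_ball])
  show "(\<lambda>r. iterate n r t) holomorphic_on ball 0 \<rho>" for n
    by (rule holomorphic_on_subset[OF iterate_holomorphic]) auto
  fix z :: complex assume "z \<in> ball 0 \<rho>"
  then have "\<exists>d>0. cball z d \<subseteq> ball 0 \<rho>"
    using open_contains_cball_eq[OF open_ball, of "0::complex" \<rho>] by blast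
  then obtain d where d: "d > 0" "cball z d \<subseteq> ball 0 \<rho>"
    by blast
  have "uniform_limit (cball z d) (\<lambda>n r. iterate n r t) (\<lambda>r. sol r t) sequentially"
    unfolding uniform_limit_iff
  proof safe
    fix e :: real assume "e > 0"
    then have "\<forall>\<^sub>F n in sequentially. \<forall>x\<in>cball 0 \<rho> \<times> {-T..T}.
        dist (case x of (r, t) \<Rightarrow> iterate n r t) (case x of (r, t) \<Rightarrow> sol r t) < e"
      using iterate_uniform_limit unfolding uniform_limit_iff by blast
    then show "\<forall>\<^sub>F n in sequentially. \<forall>x\<in>cball z d. dist (iterate n x t) (sol x t) < e"
    proof eventually_elim
      case (elim n)
      show ?case
      proof
        fix x assume "x \<in> cball z d"
        with d have "x \<in> cball 0 \<rho>" using ball_subset_cball by blast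
        with t show "dist (iterate n x t) (sol x t) < e"
            using bspec[OF elim, of "(x, t)"] by simp
      qed
    qed
  qed
  with d show "\<exists>d>0. cball z d \<subseteq> ball 0 \<rho> \<and>
      uniform_limit (cball z d) (\<lambda>n r. iterate n r t) (\<lambda>r. sol r t) sequentially" by blast
qed

text \<open>Differentiation of the limit: the derivative of iterate n + 1 is \<open>rhs\<close>
  along iterate n, and it converges uniformly because \<open>rhs\<close> is Lipschitz on the region
  where the iterates live.\<close>

lemma sol_vector_derivative:
  assumes r: "norm r \<le> \<rho>" and t: "t \<in> {-T..T}"
  shows "(sol r has_vector_derivative rhs t (sol r t)) (at t within {-T..T})"
proof -
  let ?S = "{-T..T}"
  have "\<exists>g. \<forall>x\<in>?S. (\<lambda>n. iterate (Suc n) r x) \<longlonglongrightarrow> g x \<and>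
      (g has_derivative (\<lambda>h. h *\<^sub>R rhs x (sol r x))) (at x within ?S)"
  proof (rule has_derivative_sequence)
    show "convex ?S" by simp
    show "(iterate (Suc n) r has_derivative (\<lambda>h. h *\<^sub>R rhs x (iterate n r x))) (at x within ?S)" for n x
      using iterate_vector_derivative by (simp add: has_vector_derivative_def)
    show "-T \<in> ?S" using T_pos by simp
    show "(\<lambda>n. iterate (Suc n) r (-T)) \<longlonglongrightarrow> r" by (simp add: iterate_base)
    fix e :: real assume e: "e > 0"
    define L where "L = 16 * M * \<rho>"
    have L: "L > 0" using M_pos rho_pos by (simp add: L_def)
    have "\<forall>\<^sub>F n in sequentially. \<forall>x\<in>cball 0 \<rho> \<times> ?S.
        dist (case x of (r, t) \<Rightarrow> iterate n r t) (case x of (r, t) \<Rightarrow> sol r t) < e / L"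
      using iterate_uniform_limit divide_pos_pos[OF e L] unfolding uniform_limit_iff by blast
    then show "\<forall>\<^sub>F n in sequentially. \<forall>x\<in>?S. \<forall>h.
        norm (h *\<^sub>R rhs x (iterate n r x) - h *\<^sub>R rhs x (sol r x)) \<le> e * norm h"
    proof eventually_elim
      case (elim n)
      show ?case
      proof safe
        fix x h assume x: "x \<in> ?S"
        have "norm (sol r x) \<le> 2 * norm r"
          using sol_near[OF r x] norm_triangle_sub[of "sol r x" r] norm_ge_zero[of r] by linarith
        then have "norm (rhs x (iterate n r x) - rhs x (sol r x)) \<le> L * norm (iterate n r x - sol r x)"
          unfolding L_def by (intro rhs_lipschitz[OF x r] norm_iterate_le r x)
        also have "norm (iterate n r x - sol r x) \<le> e / L"
          using bspec[OF elim, of "(r, x)"] x r by (simp add: dist_norm)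
        finally have "norm (rhs x (iterate n r x) - rhs x (sol r x)) \<le> e"
          using L by (simp add: mult_left_mono)
        then have "\<bar>h\<bar> * norm (rhs x (iterate n r x) - rhs x (sol r x)) \<le> \<bar>h\<bar> * e"
          by (intro mult_left_mono) auto
        then show "norm (h *\<^sub>R rhs x (iterate n r x) - h *\<^sub>R rhs x (sol r x)) \<le> e * norm h"
          by (simp add: scaleR_diff_right[symmetric] mult.commute del: scaleR_diff_right)
      qed
    qed
  qed
  then obtain g where g: "\<And>x. x \<in> ?S \<Longrightarrow> (\<lambda>n. iterate (Suc n) r x) \<longlonglongrightarrow> g x"
    "\<And>x. x \<in> ?S \<Longrightarrow> (g has_derivative (\<lambda>h. h *\<^sub>R rhs x (sol r x))) (at x within ?S)"
    by blast
  have eq: "g x = sol r x" if "x \<in> ?S" for x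
    using LIMSEQ_unique[OF g(1)[OF that] LIMSEQ_Suc[OF iterate_tendsto[OF r that]]] .
  show ?thesis
    unfolding has_vector_derivative_def
    by (rule has_derivative_transform[OF t _ g(2)[OF t]]) (simp add: eq)
qed

end

text \<open>
  The difference \<open>v\<close> of two solutions satisfies a linear equation \<open>v' = g v\<close>, so
  \<open>v exp (-\<integral>g)\<close> is constant.
\<close>

lemma abel_solution_unique:
  assumes T: "T > 0" and x: "abel_solution T A B x" and y: "abel_solution T A B y"
    and eq: "x (-T) = y (-T)"
  shows "x = y"
proof -
  let ?S = "{-T..T}"
  define g where "g t = poly A t * (x t ^ 2 + x t * y t + y t ^ 2) + poly B t * (x t + y t)" for t
  have derx: "(x has_real_derivative (poly A t * x t ^ 3 + poly B t * x t ^ 2)) (at t within ?S)"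
    and dery: "(y has_real_derivative (poly A t * y t ^ 3 + poly B t * y t ^ 2)) (at t within ?S)"
    if "t \<in> ?S" for t
    using x y that by (auto simp: abel_solution_def)
  have contx: "continuous_on ?S x" and conty: "continuous_on ?S y"
    using DERIV_continuous[OF derx] DERIV_continuous[OF dery]
    by (auto simp: continuous_on_eq_continuous_within)
  have contg: "continuous_on ?S g"
    unfolding g_def by (intro continuous_intros contx conty)
  define E where "E t = integral {-T..t} g" for t
  have derE: "(E has_real_derivative g t) (at t within ?S)" if "t \<in> ?S" for t
    unfolding E_def[abs_def] by (rule integral_has_real_derivative[OF contg that])
  have "((\<lambda>s. (x s - y s) * exp (- E s)) has_real_derivative 0) (at t within ?S)"
    if t: "t \<in> ?S" for t
    by (rule derivative_eq_intros refl derx[OF t] dery[OF t] derE[OF t])+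
      (simp add: g_def algebra_simps power2_eq_square power3_eq_cube)
  then have "\<exists>c. \<forall>t\<in>?S. (x t - y t) * exp (- E t) = c"
    by (intro has_field_derivative_zero_constant) auto
  then obtain c where c: "\<And>t. t \<in> ?S \<Longrightarrow> (x t - y t) * exp (- E t) = c"
    by blast
  have "c = 0"
    using c[of "-T"] T eq by simp
  then have "x t = y t" if "t \<in> ?S" for t
    using c[OF that] by simp
  moreover have "x \<in> extensional ?S" "y \<in> extensional ?S"
    using x y by (auto simp: abel_solution_def)
  ultimately show ?thesis
    by (intro extensionalityI[of _ ?S]) auto
qed

section \<open>The real flow, its fixed points and limit cycles\<close>

context picard
begin

definition flow :: "real \<Rightarrow> real \<Rightarrow> real" where
  "flow r = restrict (\<lambda>t. Re (sol (of_real r) t)) {-T..T}"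

lemma of_real_flow:
  assumes "\<bar>r\<bar> \<le> \<rho>" "t \<in> {-T..T}"
  shows "complex_of_real (flow r t) = sol (of_real r) t"
  using sol_real[of "of_real r" t] assms by (simp add: flow_def of_real_Re)

lemma flow_base: "\<bar>r\<bar> \<le> \<rho> \<Longrightarrow> flow r (-T) = r"
  using T_pos by (simp add: flow_def sol_base)

lemma flow_near:
  assumes "\<bar>r\<bar> \<le> \<rho>" "t \<in> {-T..T}"
  shows "\<bar>flow r t - r\<bar> \<le> \<bar>r\<bar> / 2"
proof -
  have "norm (complex_of_real (flow r t - r)) \<le> norm (complex_of_real r) / 2"
    unfolding of_real_diff of_real_flow[OF assms] using assms by (intro sol_near) auto
  then show ?thesis unfolding norm_of_real .
qed

lemma flow_abel_solution:
  assumes r: "\<bar>r\<bar> \<le> \<rho>"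
  shows "abel_solution T A B (flow r)"
  unfolding abel_solution_def
proof (intro conjI ballI)
  show "flow r \<in> extensional {-T..T}" by (simp add: flow_def)
  fix t assume t: "t \<in> {-T..T}"
  have "rhs t (sol (of_real r) t) = of_real (poly A t * flow r t ^ 3 + poly B t * flow r t ^ 2)"
    by (simp add: rhs_def of_real_flow[OF r t, symmetric])
  then have "((\<lambda>s. Re (sol (of_real r) s)) has_vector_derivative
      poly A t * flow r t ^ 3 + poly B t * flow r t ^ 2) (at t within {-T..T})"
    using bounded_linear.has_vector_derivative[OF bounded_linear_Re
        sol_vector_derivative[of "of_real r" t]] r t by simp
  then have "((\<lambda>s. Re (sol (of_real r) s)) has_real_derivative
      poly A t * flow r t ^ 3 + poly B t * flow r t ^ 2) (at t within {-T..T})"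
    by (simp add: has_real_derivative_iff_has_vector_derivative)
  then show "(flow r has_real_derivative poly A t * flow r t ^ 3 + poly B t * flow r t ^ 2)
      (at t within {-T..T})"
    by (rule has_field_derivative_transform_within[OF _ zero_less_one t]) (simp add: flow_def)
qed

text \<open>By uniqueness any solution starting at \<open>r\<close> is \<open>flow r\<close>, so
  closed solutions starting in the disc are the zeros of the displacement.\<close>

lemma closed_initial_value_iff:
  assumes "\<bar>r\<bar> \<le> \<rho>"
  shows "r \<in> (\<lambda>y. y (-T)) ` closed_solutions T A B \<longleftrightarrow> flow r T = r"
proof
  assume "r \<in> (\<lambda>y. y (-T)) ` closed_solutions T A B"
  then obtain y where y: "abel_solution T A B y" "y (-T) = y T" "r = y (-T)"
    by (auto simp: closed_solutions_def)
  have "flow r = y"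
    using y flow_base[OF assms]
    by (intro abel_solution_unique[OF T_pos flow_abel_solution[OF assms]]) auto
  with y show "flow r T = r" by simp
next
  assume "flow r T = r"
  then have "flow r \<in> closed_solutions T A B"
    using flow_abel_solution[OF assms] flow_base[OF assms] by (simp add: closed_solutions_def)
  then show "r \<in> (\<lambda>y. y (-T)) ` closed_solutions T A B"
    using flow_base[OF assms] by (metis image_eqI)
qed

text \<open>The displacement is the restriction to real \<open>r\<close> of a holomorphic function
  on a disc. The point \<open>q\<close> shows that this function is not identically zero, so its
  zeros are isolated.\<close>

lemma flow_limit_cycle:
  assumes r: "\<bar>r\<bar> < \<rho>" "flow r T = r" and q: "\<bar>q\<bar> < \<rho>" "flow q T \<noteq> q"
  shows "flow r \<in> limit_cycles T A B"
proof -
  have TT: "T \<in> {-T..T}" using T_pos by simp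
  have hol: "(\<lambda>z. sol z T - z) holomorphic_on ball 0 \<rho>"
    by (intro holomorphic_intros sol_holomorphic TT)
  have disp: "sol (of_real s) T - of_real s = of_real (flow s T - s)" if "\<bar>s\<bar> < \<rho>" for s
    using of_real_flow[of s T] that TT by simp
  have "sol (of_real r) T - of_real r = 0"
    using disp[OF r(1)] r(2) by simp
  moreover have "sol (of_real q) T - of_real q \<noteq> 0"
    using disp[OF q(1)] q(2) by simp
  ultimately obtain e where e: "0 < e" "ball (complex_of_real r) e \<subseteq> ball 0 \<rho>"
    and nz: "\<And>z. z \<in> ball (of_real r) e - {of_real r} \<Longrightarrow> sol z T - z \<noteq> 0"
    using isolated_zeros[OF hol open_ball connected_ball, of "of_real r" "of_real q"] r q
    by (auto simp: dist_norm)
  let ?I = "(\<lambda>y. y (-T)) ` closed_solutions T A B"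
  have "s = r" if s: "s \<in> ball r e" "s \<in> ?I" for s
  proof (rule ccontr)
    assume "s \<noteq> r"
    have "complex_of_real s \<in> ball (of_real r) e"
      using s(1) by (simp add: dist_of_real)
    moreover from this have "complex_of_real s \<in> ball 0 \<rho>"
      using e(2) by blast
    then have "\<bar>s\<bar> < \<rho>" by simp
    ultimately show False
      using nz[of "of_real s"] disp[of s] closed_initial_value_iff[of s] s(2) \<open>s \<noteq> r\<close> by auto
  qed
  moreover have rI: "r \<in> ?I"
    using closed_initial_value_iff r by simp
  ultimately have "ball r e \<inter> ?I = {r}"
    using e(1) by auto
  then have "r isolated_in ?I"
    unfolding isolated_in_def using rI open_ball by blast
  moreover have "flow r \<in> closed_solutions T A B"
    using r flow_abel_solution[of r] flow_base[of r] by (simp add: closed_solutions_def)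
  ultimately show ?thesis
    using flow_base[of r] r by (simp add: limit_cycles_def)
qed

lemma card_le_limit_cycles:
  assumes R: "finite R" "\<And>r. r \<in> R \<Longrightarrow> \<bar>r\<bar> < \<rho> \<and> flow r T = r"
    and q: "\<bar>q\<bar> < \<rho>" "flow q T \<noteq> q"
  shows "enat (card R) \<le> ecard (limit_cycles T A B)"
proof -
  have sub: "flow ` R \<subseteq> limit_cycles T A B"
    using flow_limit_cycle R(2) q by blast
  have "inj_on flow R"
    using flow_base R(2) by (intro inj_onI) (metis less_imp_le)
  then have "card (flow ` R) = card R"
    by (rule card_image)
  then show ?thesis
    using card_mono[OF _ sub] by (auto simp: ecard_def)
qed

lemma continuous_on_flow: "continuous_on {-\<rho><..<\<rho>} (\<lambda>r. flow r T)"
proof -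
  have TT: "T \<in> {-T..T}" using T_pos by simp
  have "continuous_on {-\<rho><..<\<rho>} (\<lambda>r. Re (sol (of_real r) T))"
    by (intro continuous_on_Re continuous_on_compose2[OF
          holomorphic_on_imp_continuous_on[OF sol_holomorphic[OF TT]]] continuous_intros) auto
  then show ?thesis
    using TT by (simp add: flow_def)
qed

end

section \<open>Melnikov functions\<close>

lemma sgn_eq_if_close:
  fixes a b :: real
  shows "\<bar>a - b\<bar> < \<bar>b\<bar> \<Longrightarrow> sgn a = sgn b"
  by (auto simp: sgn_if abs_if split: if_splits)

lemma continuous_on_Icc_bounded:
  fixes f :: "real \<Rightarrow> real"
  assumes "continuous_on {a..b} f"
  shows "\<exists>K>0. \<forall>t\<in>{a..b}. \<bar>f t\<bar> \<le> K"
  using compact_imp_bounded[OF compact_continuous_image[OF assms]] by (auto simp: bounded_pos)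

lemma poly_Icc_bounded: "\<exists>K>0. \<forall>t\<in>{a..b}. \<bar>poly p (t::real)\<bar> \<le> K"
  by (rule continuous_on_Icc_bounded) (rule continuous_on_poly[OF continuous_on_id])

lemma sqrt_lipschitz:
  fixes y h :: real
  assumes "1 \<le> y" "0 \<le> y + h"
  shows "\<bar>sqrt (y + h) - sqrt y\<bar> \<le> \<bar>h\<bar>"
proof -
  have y: "1 \<le> sqrt y" using assms by simp
  have "(sqrt (y + h) - sqrt y) * (sqrt (y + h) + sqrt y) = h"
    using assms by (simp add: algebra_simps)
  then have "\<bar>sqrt (y + h) - sqrt y\<bar> * (sqrt (y + h) + sqrt y) = \<bar>h\<bar>"
    using y assms(2) by (metis abs_mult abs_of_nonneg add_nonneg_nonneg order_trans real_sqrt_ge_zero zero_le_one)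
  moreover have "\<bar>sqrt (y + h) - sqrt y\<bar> * 1 \<le> \<bar>sqrt (y + h) - sqrt y\<bar> * (sqrt (y + h) + sqrt y)"
    using y real_sqrt_ge_zero[OF assms(2)] by (intro mult_left_mono) linarith+
  ultimately show ?thesis by simp
qed

lemma sqrt_linear_approx:
  fixes y h :: real
  assumes y: "1 \<le> y" and yh: "0 \<le> y + h"
  shows "\<bar>sqrt (y + h) - sqrt y - h / (2 * sqrt y)\<bar> \<le> h\<^sup>2"
proof -
  define u v where "u = sqrt y" and "v = sqrt (y + h)"
  have u: "1 \<le> u" and v: "0 \<le> v" using assms by (auto simp: u_def v_def)
  have h: "h = v\<^sup>2 - u\<^sup>2" using assms by (simp add: u_def v_def)
  have "v - u - h / (2 * u) = - ((v - u)\<^sup>2 / (2 * u))"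
    using u by (simp add: h field_simps power2_eq_square)
  then have "\<bar>v - u - h / (2 * u)\<bar> = (v - u)\<^sup>2 / (2 * u)"
    using u by simp
  also have "\<dots> \<le> (v - u)\<^sup>2 / 1"
    using u by (intro divide_left_mono) auto
  also have "\<dots> \<le> h\<^sup>2"
    using sqrt_lipschitz[OF assms] by (simp add: u_def v_def abs_le_square_iff[symmetric])
  finally show ?thesis by (simp add: u_def v_def)
qed

lemma integral_odd:
  fixes f :: "real \<Rightarrow> real"
  assumes "\<And>t. f (- t) = - f t"
  shows "integral {-a..a} f = 0"
proof -
  have "integral {-a..a} f = integral {-a..a} (\<lambda>t. f (- t))"
    using Henstock_Kurzweil_Integration.integral_reflect_real[of a "-a" f] by simp
  also have "\<dots> = - integral {-a..a} f"
    by (simp add: assms)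
  finally show ?thesis by simp
qed

text \<open>Hoelder continuity with exponent 1/2, for radicands that are only known to be
  nonnegative; the Lipschitz bound above asks for one radicand to be at least 1.\<close>

lemma sqrt_diff_le:
  fixes a b :: real
  assumes "0 \<le> a" "0 \<le> b"
  shows "\<bar>sqrt a - sqrt b\<bar> \<le> sqrt \<bar>a - b\<bar>"
proof -
  have *: "sqrt a - sqrt b \<le> sqrt \<bar>a - b\<bar>" if "0 \<le> b" "b \<le> a" for a b :: real
    using sqrt_add_le_add_sqrt[of "a - b" b] that by simp
  show ?thesis
    using *[of a b] *[of b a] assms by (cases "a \<le> b") (auto simp: abs_if)
qed

text \<open>
  In the coordinate \<open>V = 1 / x\<^sup>2\<close> the equation reads \<open>V' = - 2 A - 2 B / x\<close>, so \<open>B = 0\<close> gives a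
  center when \<open>\<integral>A = 0\<close>, and for small \<open>B = \<delta> b\<close> the displacement is governed by the first Melnikov
  function \<open>\<integral> b \<surd>V\<close> along the unperturbed solution.
\<close>

lemma displacement_sign:
  fixes T r :: real and al b :: "real poly"
  defines "N \<equiv> integral {-T..T} (\<lambda>t. poly b t * sqrt (1 - 2 * r\<^sup>2 * poly al t))"
  assumes T: "T > 0" and r: "r \<noteq> 0"
    and ends: "poly al (-T) = 0" "poly al T = 0"
    and pos: "\<And>t. t \<in> {-T..T} \<Longrightarrow> 0 \<le> 1 - 2 * r\<^sup>2 * poly al t"
    and N: "N \<noteq> 0"
  shows "\<exists>\<delta>0>0. \<forall>\<delta> x. 0 < \<delta> \<and> \<delta> \<le> \<delta>0 \<and> abel_solution T (pderiv al) (smult \<delta> b) x \<and> x (-T) = r \<and>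
           (\<forall>t\<in>{-T..T}. \<bar>x t - r\<bar> \<le> \<bar>r\<bar> / 2) \<longrightarrow> sgn (x T - r) = sgn N"
proof -
  let ?S = "{-T..T}"
  obtain K where K: "K > 0" "\<And>t. t \<in> ?S \<Longrightarrow> \<bar>poly b t\<bar> \<le> K"
    using poly_Icc_bounded[of "-T" T b] by blast
  \<comment> \<open>\<open>\<delta> * C\<close> bounds the drift of \<open>V + 2 al\<close>: its
    derivative is at most \<open>4 * \<delta> * K / |r|\<close> in absolute value, over a time of at
    most \<open>2 * T\<close>. Its square root is at most \<eta> once
    \<open>\<delta> \<le> \<eta>^2 / C\<close>, and \<eta> is chosen so that the resulting integral
    error \<open>2 * T * K * \<eta>\<close> is half of \<open>|N| / |r|\<close>.\<close>
  define C where "C = 8 * K * T / \<bar>r\<bar>"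
  have C: "C > 0" using K(1) T r by (simp add: C_def)
  define \<eta> where "\<eta> = \<bar>N\<bar> / (\<bar>r\<bar> * (4 * T * K))"
  have \<eta>: "\<eta> > 0" using K(1) T r N by (simp add: \<eta>_def)
  have \<eta>_less: "2 * T * (K * \<eta>) < \<bar>N\<bar> / \<bar>r\<bar>"
    using K(1) T r N by (simp add: \<eta>_def field_simps)
  have "sgn (x T - r) = sgn N"
    if \<delta>: "0 < \<delta>" "\<delta> \<le> \<eta>\<^sup>2 / C" and sol: "abel_solution T (pderiv al) (smult \<delta> b) x"
      and x0: "x (-T) = r" and near: "\<forall>t\<in>?S. \<bar>x t - r\<bar> \<le> \<bar>r\<bar> / 2" for \<delta> x
  proof -
    have xlow: "\<bar>r\<bar> / 2 \<le> \<bar>x t\<bar>" if "t \<in> ?S" for t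
      using bspec[OF near that] by linarith
    have xsgn: "sgn (x t) = sgn r" if "t \<in> ?S" for t
      using bspec[OF near that] r by (auto simp: sgn_if abs_if split: if_splits)
    have xnz: "x t \<noteq> 0" if "t \<in> ?S" for t
      using xlow[OF that] r by auto
    have derx: "(x has_real_derivative (poly (pderiv al) t * x t ^ 3 + \<delta> * poly b t * x t ^ 2)) (at t within ?S)"
      if "t \<in> ?S" for t using sol that by (auto simp: abel_solution_def)
    have contx: "continuous_on ?S x"
      using DERIV_continuous[OF derx] by (auto simp: continuous_on_eq_continuous_within)
    define V where "V t = 1 / (x t)\<^sup>2" for t
    have contV: "continuous_on ?S V"
      unfolding V_def by (intro continuous_intros contx) (use xnz in auto)
    \<comment> \<open>The sign of \<open>x\<close> is that of \<open>r\<close> throughout, which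
      turns the term \<open>1 / x\<close> of the equation for \<open>V\<close> into
      \<open>sgn r * sqrt V\<close>.\<close>
    have sqrtV: "sqrt (V t) = sgn r / x t" if "t \<in> ?S" for t
      using xsgn[OF that] xnz[OF that]
      by (auto simp: V_def real_sqrt_divide sgn_if abs_if split: if_splits)
    have derW: "((\<lambda>t. V t + 2 * poly al t) has_real_derivative - 2 * \<delta> * sgn r * (poly b t * sqrt (V t)))
        (at t within ?S)" if t: "t \<in> ?S" for t
    proof -
      have der_al: "(poly al has_real_derivative poly (pderiv al) t) (at t within ?S)"
        by (rule DERIV_subset[OF poly_DERIV]) simp
      have "((\<lambda>s. 1 / (x s)\<^sup>2) has_real_derivative
          - (2 * x t * (poly (pderiv al) t * x t ^ 3 + \<delta> * poly b t * x t ^ 2)) / (x t ^ 4)) (at t within ?S)"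
        using xnz[OF t] by (auto intro!: derivative_eq_intros derx[OF t] simp: field_simps power2_eq_square eval_nat_numeral)
      from DERIV_add[OF this DERIV_cmult[OF der_al, of 2]] show ?thesis
        unfolding sqrtV[OF t] unfolding V_def
        by (rule DERIV_cong)
          (use xnz[OF t] r in \<open>auto simp: field_simps sgn_if eval_nat_numeral\<close>)
    qed
    have W_bound: "\<bar>poly b t * sqrt (V t)\<bar> \<le> K * (2 / \<bar>r\<bar>)" if t: "t \<in> ?S" for t
    proof -
      have "\<bar>sqrt (V t)\<bar> \<le> 2 / \<bar>r\<bar>"
        using xlow[OF t] xnz[OF t] r by (simp add: V_def real_sqrt_divide field_simps)
      then show ?thesis
        unfolding abs_mult using K(1) K(2)[OF t] by (intro mult_mono) auto
    qed
    have V_near: "\<bar>V t - (1 / r\<^sup>2 - 2 * poly al t)\<bar> \<le> \<delta> * C" if t: "t \<in> ?S" for t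
    proof -
      have "norm ((V t + 2 * poly al t) - (V (-T) + 2 * poly al (-T))) \<le>
          2 * \<delta> * (K * (2 / \<bar>r\<bar>)) * norm (t - - T)"
      proof (rule field_differentiable_bound[of ?S _ "\<lambda>t. - 2 * \<delta> * sgn r * (poly b t * sqrt (V t))"])
        fix u assume u: "u \<in> ?S"
        show "norm (- 2 * \<delta> * sgn r * (poly b u * sqrt (V u))) \<le> 2 * \<delta> * (K * (2 / \<bar>r\<bar>))"
        proof -
          have "norm (- 2 * \<delta> * sgn r * (poly b u * sqrt (V u))) = 2 * \<delta> * \<bar>poly b u * sqrt (V u)\<bar>"
            using \<delta>(1) r by (simp add: abs_mult abs_sgn_eq)
          also have "\<dots> \<le> 2 * \<delta> * (K * (2 / \<bar>r\<bar>))"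
            using W_bound[OF u] \<delta>(1) by (intro mult_left_mono) auto
          finally show ?thesis .
        qed
      qed (use derW t T in auto)
      also have "\<dots> \<le> 2 * \<delta> * (K * (2 / \<bar>r\<bar>)) * (2 * T)"
        using t \<delta>(1) K(1) by (intro mult_left_mono) auto
      also have "\<dots> = \<delta> * C" by (simp add: C_def)
      finally show ?thesis
        using ends x0 by (simp add: V_def algebra_simps)
    qed
    define I where "I = integral ?S (\<lambda>t. poly b t * sqrt (V t))"
    have base: "1 / r\<^sup>2 - 2 * poly al t = (1 - 2 * r\<^sup>2 * poly al t) / r\<^sup>2" for t
      using r by (simp add: field_simps)
    have N_eq: "integral ?S (\<lambda>t. poly b t * sqrt (1 / r\<^sup>2 - 2 * poly al t)) = N / \<bar>r\<bar>"
      unfolding base real_sqrt_divide N_def by simp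
    have int1: "(\<lambda>t. poly b t * sqrt (V t)) integrable_on ?S"
      and int2: "(\<lambda>t. poly b t * sqrt (1 / r\<^sup>2 - 2 * poly al t)) integrable_on ?S"
      by (intro integrable_continuous_real continuous_intros contV)+
    have "\<bar>I - N / \<bar>r\<bar>\<bar> = norm (integral ?S (\<lambda>t. poly b t * sqrt (V t) - poly b t * sqrt (1 / r\<^sup>2 - 2 * poly al t)))"
      unfolding I_def N_eq[symmetric] by (subst integral_diff[OF int1 int2]) simp
    also have "\<dots> \<le> K * \<eta> * (T - - T)"
    proof (rule integral_bound)
      fix t assume t: "t \<in> ?S"
      have "\<bar>sqrt (V t) - sqrt (1 / r\<^sup>2 - 2 * poly al t)\<bar> \<le> sqrt \<bar>V t - (1 / r\<^sup>2 - 2 * poly al t)\<bar>"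
        using pos[OF t] by (intro sqrt_diff_le) (auto simp: V_def base)
      also have "\<dots> \<le> sqrt (\<eta>\<^sup>2)"
        using V_near[OF t] \<delta>(2) C by (simp add: field_simps del: real_sqrt_abs)
      also have "\<dots> = \<eta>" using \<eta> by simp
      finally show "norm (poly b t * sqrt (V t) - poly b t * sqrt (1 / r\<^sup>2 - 2 * poly al t)) \<le> K * \<eta>"
        unfolding right_diff_distrib[symmetric] real_norm_def abs_mult
        using K(1) K(2)[OF t] by (intro mult_mono) auto
    qed (use T in \<open>auto intro!: continuous_intros contV\<close>)
    also have "\<dots> < \<bar>N\<bar> / \<bar>r\<bar>"
      using \<eta>_less by (simp add: algebra_simps)
    finally have "\<bar>I - N / \<bar>r\<bar>\<bar> < \<bar>N / \<bar>r\<bar>\<bar>" by simp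
    then have "sgn I = sgn (N / \<bar>r\<bar>)"
      by (rule sgn_eq_if_close)
    then have sgnI: "sgn I = sgn N"
      using r by (simp add: sgn_divide)
    have "((\<lambda>t. - 2 * \<delta> * sgn r * (poly b t * sqrt (V t))) has_integral
        (V T + 2 * poly al T) - (V (-T) + 2 * poly al (-T))) ?S"
      using T derW by (intro fundamental_theorem_of_calculus)
        (auto simp: has_real_derivative_iff_has_vector_derivative[symmetric])
    then have "V T - V (-T) = integral ?S (\<lambda>t. (- 2 * \<delta> * sgn r) * (poly b t * sqrt (V t)))"
      using ends by (subst integral_unique) (auto simp: mult.assoc)
    also have "\<dots> = - 2 * \<delta> * sgn r * I"
      unfolding I_def by (rule integral_mult_right)
    finally have VI: "V (-T) - V T = 2 * \<delta> * sgn r * I" by simp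
    have TT: "T \<in> ?S" using T by simp
    have "V (-T) - V T = (x T - r) * ((x T + r) / (r\<^sup>2 * (x T)\<^sup>2))"
      using r xnz[OF TT] x0 by (simp add: V_def field_simps power2_eq_square)
    moreover have "sgn ((x T + r) / (r\<^sup>2 * (x T)\<^sup>2)) = sgn r"
    proof -
      have "sgn (x T + r) = sgn r"
        using bspec[OF near TT] r by (auto simp: sgn_if abs_if split: if_splits)
      moreover have "0 < r\<^sup>2 * (x T)\<^sup>2"
        using r xnz[OF TT] by simp
      ultimately show ?thesis by (simp add: sgn_divide)
    qed
    \<comment> \<open>Both sides carry a factor \<open>sgn r\<close>, one from
      \<open>x T + r\<close> and one from \<open>1 / x\<close>. They cancel, so the displacement has
      the same sign at \<open>r\<close> and at \<open>-r\<close>.\<close>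
    ultimately have "sgn (x T - r) * sgn r = sgn (2 * \<delta> * sgn r * I)"
      using VI by (metis sgn_mult)
    also have "\<dots> = sgn r * sgn I"
      using \<delta>(1) by (simp add: sgn_mult)
    finally show ?thesis using sgnI r by (simp add: sgn_if split: if_splits)
  qed
  moreover have "\<eta>\<^sup>2 / C > 0" using \<eta> C by simp
  ultimately show ?thesis by blast
qed

section \<open>Expansion of the Melnikov integral to first order in \<epsilon>\<close>

definition weight :: "real \<Rightarrow> real poly" where
  "weight T = [:T\<^sup>2, 0, -1:]"

lemma poly_weight: "poly (weight T) t = T\<^sup>2 - t\<^sup>2"
  by (simp add: weight_def power2_eq_square)

lemma weight_nonneg: "t \<in> {-T..T} \<Longrightarrow> 0 \<le> poly (weight T) t"
  by (auto simp: poly_weight abs_le_square_iff[symmetric])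

lemma degree_pcompose_weight: "degree (pcompose p (weight T)) = 2 * degree p"
  by (simp add: weight_def degree_pcompose)

definition melnikov_integrand :: "real \<Rightarrow> real \<Rightarrow> real poly \<Rightarrow> real \<Rightarrow> real \<Rightarrow> real" where
  "melnikov_integrand T \<beta> p z t = (let w = poly (weight T) t in
     \<beta> * sqrt (1 + z * w) + z * (t\<^sup>2 * w * poly p w) / sqrt (1 + z * w))"

definition melnikov :: "real \<Rightarrow> real \<Rightarrow> real poly \<Rightarrow> real \<Rightarrow> real" where
  "melnikov T \<beta> p z = integral {-T..T} (melnikov_integrand T \<beta> p z)"

text \<open>The primitive of the cubic coefficient, which itself is
  \<open>t - \<epsilon> * (t w p(w))'\<close>. The common factor \<open>w\<close> makes the
  primitive vanish at both ends, so the system with \<open>B = 0\<close> is a center for every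
  \<epsilon>.\<close>

definition perturbed_potential :: "real \<Rightarrow> real poly \<Rightarrow> real \<Rightarrow> real poly" where
  "perturbed_potential T p \<epsilon> =
     smult (-1/2) (weight T) - smult \<epsilon> ([:0, 1:] * weight T * pcompose p (weight T))"

definition perturbed_b :: "real \<Rightarrow> real poly \<Rightarrow> real \<Rightarrow> real \<Rightarrow> real poly" where
  "perturbed_b T p \<beta> \<epsilon> = [:0, 1:] * pcompose p (weight T) + [:\<epsilon> * \<beta>:]"

text \<open>At \<epsilon> = 0 the integrand is odd. The coefficient of \<epsilon> is exactly
  \<open>melnikov\<close>, and the remainder is of order \<epsilon>^2.\<close>

lemma first_order_melnikov_sign:
  assumes T: "T > 0" and z: "z > 0" and G: "melnikov T \<beta> (p1 * p2) z \<noteq> 0"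
  shows "\<forall>\<^sub>F \<epsilon> in at_right 0.
    (\<forall>t\<in>{-T..T}. 0 \<le> 1 - 2 * z * poly (perturbed_potential T p2 \<epsilon>) t) \<and>
    sgn (integral {-T..T} (\<lambda>t. poly (perturbed_b T p1 \<beta> \<epsilon>) t *
           sqrt (1 - 2 * z * poly (perturbed_potential T p2 \<epsilon>) t))) =
    sgn (melnikov T \<beta> (p1 * p2) z)"
proof -
  let ?S = "{-T..T}"
  define w where "w = poly (weight T)"
  define y where "y t = 1 + z * w t" for t
  define c where "c t = t * poly p1 (w t)" for t
  define k where "k t = 2 * z * (t * w t * poly p2 (w t))" for t
  define G where "G = melnikov T \<beta> (p1 * p2) z"
  define N where "N \<epsilon> = integral ?S (\<lambda>t. (c t + \<epsilon> * \<beta>) * sqrt (y t + \<epsilon> * k t))" for \<epsilon>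
  have pot: "1 - 2 * z * poly (perturbed_potential T p2 \<epsilon>) t = y t + \<epsilon> * k t" for \<epsilon> t
    by (simp add: perturbed_potential_def y_def k_def w_def poly_pcompose algebra_simps)
  have b: "poly (perturbed_b T p1 \<beta> \<epsilon>) t = c t + \<epsilon> * \<beta>" for \<epsilon> t
    by (simp add: perturbed_b_def c_def w_def poly_pcompose)
  have y1: "1 \<le> y t" if "t \<in> ?S" for t
    using weight_nonneg[OF that] z by (simp add: y_def w_def)
  have cont: "continuous_on ?S c" "continuous_on ?S k" "continuous_on ?S y"
    unfolding c_def k_def y_def w_def by (intro continuous_intros)+
  obtain Kc where Kc: "Kc > 0" "\<And>t. t \<in> ?S \<Longrightarrow> \<bar>c t\<bar> \<le> Kc" using continuous_on_Icc_bounded[OF cont(1)] by blast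
  obtain Kk where Kk: "Kk > 0" "\<And>t. t \<in> ?S \<Longrightarrow> \<bar>k t\<bar> \<le> Kk" using continuous_on_Icc_bounded[OF cont(2)] by blast
  \<comment> \<open>Pointwise coefficient of \<epsilon>^2 in the remainder: the first summand comes
    from the linear approximation of the root in the term with \<open>c\<close>, the second from the
    Lipschitz bound in the term with \<beta>.\<close>
  define L where "L = Kc * Kk\<^sup>2 + \<bar>\<beta>\<bar> * Kk"
  have G_eq: "G = integral ?S (\<lambda>t. c t * (k t / (2 * sqrt (y t))) + \<beta> * sqrt (y t))"
    unfolding G_def melnikov_def
    by (intro arg_cong2[where f=integral] refl ext)
      (simp add: melnikov_integrand_def Let_def c_def k_def y_def w_def power2_eq_square)
  have odd: "integral ?S (\<lambda>t. c t * sqrt (y t)) = 0"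
    by (rule integral_odd) (simp add: c_def y_def w_def poly_weight)
  \<comment> \<open>The bound \<open>1 / Kk\<close> keeps the radicand nonnegative, since
    \<open>y \<ge> 1\<close>. The other bound makes \<open>2 * T * L * \<epsilon>^2\<close> smaller
    than \<open>\<epsilon> * |G|\<close>; its summand 1 makes the denominator positive from
    \<open>0 \<le> L\<close> alone.\<close>
  have main: "(\<forall>t\<in>?S. 0 \<le> y t + \<epsilon> * k t) \<and> sgn (N \<epsilon>) = sgn G"
    if eps: "0 < \<epsilon>" "\<epsilon> < 1 / Kk" "\<epsilon> < \<bar>G\<bar> / (2 * T * L + 1)" for \<epsilon>
  proof -
    have nn: "0 \<le> y t + \<epsilon> * k t" if "t \<in> ?S" for t
    proof -
      have "\<bar>\<epsilon> * k t\<bar> \<le> \<epsilon> * Kk" using eps(1) Kk(2)[OF that] by (simp add: abs_mult)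
      also have "\<dots> \<le> 1" using eps(2) Kk(1) by (simp add: field_simps)
      finally show ?thesis using y1[OF that] by linarith
    qed
    have L0: "0 \<le> L" using Kc(1) Kk(1) by (simp add: L_def)
    have int: "(\<lambda>t. (c t + \<epsilon> * \<beta>) * sqrt (y t + \<epsilon> * k t)) integrable_on ?S"
      "(\<lambda>t. c t * sqrt (y t)) integrable_on ?S"
      "(\<lambda>t. c t * (k t / (2 * sqrt (y t))) + \<beta> * sqrt (y t)) integrable_on ?S"
      by (intro integrable_continuous_real continuous_intros cont; use y1 in force)+
    have "\<bar>N \<epsilon> - \<epsilon> * G\<bar> = norm (integral ?S (\<lambda>t. (c t + \<epsilon> * \<beta>) * sqrt (y t + \<epsilon> * k t) - c t * sqrt (y t)
         - \<epsilon> * (c t * (k t / (2 * sqrt (y t))) + \<beta> * sqrt (y t))))"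
      unfolding N_def G_eq
      by (subst integral_diff[OF integrable_diff[OF int(1,2)] integrable_cmul[OF int(3), of \<epsilon>, unfolded real_scaleR_def]],
          subst integral_diff[OF int(1,2)], subst integral_mult_right)
         (simp add: odd)
    also have "\<dots> \<le> (\<epsilon>\<^sup>2 * L) * (T - - T)"
    proof (rule integral_bound)
      fix t assume t: "t \<in> ?S"
      have 1: "\<bar>c t * (sqrt (y t + \<epsilon> * k t) - sqrt (y t) - (\<epsilon> * k t) / (2 * sqrt (y t)))\<bar> \<le> Kc * (\<epsilon> * Kk)\<^sup>2"
        unfolding abs_mult
      proof (intro mult_mono)
        have "\<bar>sqrt (y t + \<epsilon> * k t) - sqrt (y t) - (\<epsilon> * k t) / (2 * sqrt (y t))\<bar> \<le> (\<epsilon> * k t)\<^sup>2"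
          by (rule sqrt_linear_approx[OF y1[OF t] nn[OF t]])
        also have "\<dots> \<le> (\<epsilon> * Kk)\<^sup>2"
          using Kk(1) Kk(2)[OF t] eps(1) by (simp add: abs_le_square_iff[symmetric] abs_mult)
        finally show "\<bar>sqrt (y t + \<epsilon> * k t) - sqrt (y t) - (\<epsilon> * k t) / (2 * sqrt (y t))\<bar> \<le> (\<epsilon> * Kk)\<^sup>2" .
      qed (use Kc t in auto)
      have 2: "\<bar>\<epsilon> * \<beta> * (sqrt (y t + \<epsilon> * k t) - sqrt (y t))\<bar> \<le> \<epsilon> * \<bar>\<beta>\<bar> * (\<epsilon> * Kk)"
        unfolding abs_mult
      proof (intro mult_mono)
        have "\<bar>sqrt (y t + \<epsilon> * k t) - sqrt (y t)\<bar> \<le> \<bar>\<epsilon> * k t\<bar>"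
          by (rule sqrt_lipschitz[OF y1[OF t] nn[OF t]])
        also have "\<dots> \<le> \<epsilon> * Kk"
          using Kk(2)[OF t] eps(1) by (simp add: abs_mult)
        finally show "\<bar>sqrt (y t + \<epsilon> * k t) - sqrt (y t)\<bar> \<le> \<epsilon> * Kk" .
      qed (use eps(1) in auto)
      have "(c t + \<epsilon> * \<beta>) * sqrt (y t + \<epsilon> * k t) - c t * sqrt (y t)
         - \<epsilon> * (c t * (k t / (2 * sqrt (y t))) + \<beta> * sqrt (y t)) =
        c t * (sqrt (y t + \<epsilon> * k t) - sqrt (y t) - (\<epsilon> * k t) / (2 * sqrt (y t))) +
        \<epsilon> * \<beta> * (sqrt (y t + \<epsilon> * k t) - sqrt (y t))"
        by (simp add: algebra_simps)
      then have "norm ((c t + \<epsilon> * \<beta>) * sqrt (y t + \<epsilon> * k t) - c t * sqrt (y t)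
         - \<epsilon> * (c t * (k t / (2 * sqrt (y t))) + \<beta> * sqrt (y t))) \<le>
         Kc * (\<epsilon> * Kk)\<^sup>2 + \<epsilon> * \<bar>\<beta>\<bar> * (\<epsilon> * Kk)"
        using 1 2 unfolding real_norm_def by linarith
      also have "\<dots> = \<epsilon>\<^sup>2 * L"
        by (simp add: L_def power2_eq_square algebra_simps)
      finally show "norm ((c t + \<epsilon> * \<beta>) * sqrt (y t + \<epsilon> * k t) - c t * sqrt (y t)
         - \<epsilon> * (c t * (k t / (2 * sqrt (y t))) + \<beta> * sqrt (y t))) \<le> \<epsilon>\<^sup>2 * L" .
    next
      show "- T \<le> T" using T by simp
      show "continuous_on ?S (\<lambda>t. (c t + \<epsilon> * \<beta>) * sqrt (y t + \<epsilon> * k t) - c t * sqrt (y t)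
         - \<epsilon> * (c t * (k t / (2 * sqrt (y t))) + \<beta> * sqrt (y t)))"
        by (intro continuous_intros cont; use y1 in force)
    qed
    also have "\<dots> = \<epsilon> * (\<epsilon> * (2 * T * L))"
      by (simp add: power2_eq_square)
    also have "\<dots> < \<epsilon> * \<bar>G\<bar>"
    proof (intro mult_strict_left_mono eps(1))
      have pos: "0 < 2 * T * L + 1" using T L0 by (simp add: add_nonneg_pos)
      have "\<epsilon> * (2 * T * L) \<le> \<epsilon> * (2 * T * L + 1)" using eps(1) by (simp add: algebra_simps)
      also have "\<dots> < \<bar>G\<bar>" using eps(3) pos by (simp add: pos_less_divide_eq)
      finally show "\<epsilon> * (2 * T * L) < \<bar>G\<bar>" .
    qed
    finally have "\<bar>N \<epsilon> - \<epsilon> * G\<bar> < \<bar>\<epsilon> * G\<bar>" using eps(1) by (simp add: abs_mult)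
    then have "sgn (N \<epsilon>) = sgn (\<epsilon> * G)"
      by (rule sgn_eq_if_close)
    also have "\<dots> = sgn G"
      using eps(1) by (simp add: sgn_mult)
    finally show ?thesis using nn by blast
  qed
  have L0: "0 \<le> L" using Kc(1) Kk(1) by (simp add: L_def)
  define e where "e = min (1 / Kk) (\<bar>G\<bar> / (2 * T * L + 1))"
  have "0 < e"
    using Kk(1) T L0 assms(3) by (auto simp: e_def G_def add_nonneg_pos)
  moreover have "\<forall>\<epsilon>>0. \<epsilon> < e \<longrightarrow> (\<forall>t\<in>?S. 0 \<le> y t + \<epsilon> * k t) \<and> sgn (N \<epsilon>) = sgn G"
    using main by (auto simp: e_def)
  ultimately show ?thesis
    unfolding eventually_at_right_field pot b N_def[symmetric] G_def[symmetric] by blast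
qed

section \<open>Orthogonal polynomials in the variable w for the weight t^2 w dt\<close>

definition weighted_ip :: "real \<Rightarrow> real poly \<Rightarrow> real poly \<Rightarrow> real" where
  "weighted_ip T p q = integral {-T..T}
     (\<lambda>t. t\<^sup>2 * poly (weight T) t * poly p (poly (weight T) t) * poly q (poly (weight T) t))"

lemma continuous_on_poly_weight [continuous_intros]:
  "continuous_on S (\<lambda>t. poly p (poly (weight T) t))"
  by (intro continuous_on_poly continuous_intros)

lemma weighted_ip_commute: "weighted_ip T p q = weighted_ip T q p"
  by (simp add: weighted_ip_def mult_ac)

lemma weighted_ip_add: "weighted_ip T p (q + r) = weighted_ip T p q + weighted_ip T p r"
  unfolding weighted_ip_def poly_add distrib_left
  by (rule integral_add; intro integrable_continuous_real continuous_intros)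

lemma weighted_ip_smult: "weighted_ip T p (smult c q) = c * weighted_ip T p q"
  unfolding weighted_ip_def poly_smult
  by (simp add: integral_mult_right[symmetric] mult_ac del: integral_mult_right)

lemma weighted_ip_0: "weighted_ip T p 0 = 0"
  by (simp add: weighted_ip_def)

lemma weighted_ip_diff: "weighted_ip T p (q - r) = weighted_ip T p q - weighted_ip T p r"
  using weighted_ip_add[of T p q "smult (-1) r"] weighted_ip_smult[of T p "-1" r] by simp

lemma weighted_ip_sum: "weighted_ip T p (\<Sum>i\<in>I. f i) = (\<Sum>i\<in>I. weighted_ip T p (f i))"
  by (induction I rule: infinite_finite_induct) (simp_all add: weighted_ip_0 weighted_ip_add)

text \<open>The integrand is continuous and nonnegative, so a zero integral makes it vanish
  everywhere. As \<open>t\<close> runs through (0, T), where the weight is positive,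
  \<open>w\<close> takes infinitely many values, all of them roots of \<open>p\<close>.\<close>

lemma weighted_ip_self_neq_0:
  assumes T: "T > 0" and p: "p \<noteq> 0"
  shows "weighted_ip T p p \<noteq> 0"
proof
  let ?f = "\<lambda>t. t\<^sup>2 * poly (weight T) t * poly p (poly (weight T) t) * poly p (poly (weight T) t)"
  assume 0: "weighted_ip T p p = 0"
  have nonneg: "0 \<le> ?f t" if "t \<in> {-T..T}" for t
    using weight_nonneg[OF that] by (simp add: mult.assoc)
  have "\<forall>t\<in>{-T..T}. ?f t = 0"
    using 0 unfolding weighted_ip_def
    by (subst (asm) integral_eq_0_iff) (use T nonneg in \<open>auto intro!: continuous_intros\<close>)
  then have f0: "?f t = 0" if "t \<in> {-T..T}" for t using that by blast
  have zero: "poly p (T\<^sup>2 - t\<^sup>2) = 0" if t: "t \<in> {0<..<T}" for t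
  proof -
    have "t\<^sup>2 < T\<^sup>2" using t by (intro power_strict_mono) auto
    then show ?thesis using f0[of t] t by (auto simp: poly_weight)
  qed
  have "(\<lambda>t. T\<^sup>2 - t\<^sup>2) ` {0<..<T} \<subseteq> {x. poly p x = 0}"
    using zero by auto
  moreover have "inj_on (\<lambda>t. T\<^sup>2 - t\<^sup>2) {0<..<T}"
    by (auto simp: inj_on_def power2_eq_iff)
  then have "infinite ((\<lambda>t. T\<^sup>2 - t\<^sup>2) ` {0<..<T})"
    using T by (simp add: finite_image_iff infinite_Ioo)
  ultimately show False
    using poly_roots_finite[OF p] finite_subset by blast
qed

text \<open>Gram-Schmidt applied to the monomials, without normalization so that the polynomials
  stay monic.\<close>

lemma orthogonal_polynomial_exists:
  assumes T: "T > 0"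
  shows "\<exists>P. degree P = k \<and> lead_coeff P = 1 \<and> (\<forall>q. degree q < k \<longrightarrow> weighted_ip T P q = 0)"
proof (induction k rule: less_induct)
  case (less k)
  then obtain P where P: "\<And>j. j < k \<Longrightarrow> degree (P j) = j" "\<And>j. j < k \<Longrightarrow> lead_coeff (P j) = 1"
    "\<And>j q. j < k \<Longrightarrow> degree q < j \<Longrightarrow> weighted_ip T (P j) q = 0"
    by metis
  define ps where "ps j = smult (weighted_ip T (monom 1 k) (P j) / weighted_ip T (P j) (P j)) (P j)" for j
  define Q where "Q = monom 1 k - (\<Sum>j<k. ps j)"
  have coeff_ps: "coeff (\<Sum>j<k. ps j) i = 0" if "i \<ge> k" for i
    using that P(1) by (simp add: coeff_sum ps_def coeff_eq_0)
  have coeffQ: "coeff Q k = 1" "\<And>i. i > k \<Longrightarrow> coeff Q i = 0"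
    using coeff_ps by (simp_all add: Q_def)
  have degQ: "degree Q = k"
    using coeffQ by (intro antisym degree_le le_degree) auto
  have orth: "weighted_ip T Q (P i) = 0" if i: "i < k" for i
  proof -
    have nz: "P i \<noteq> 0" using P(2)[OF i] by auto
    have "weighted_ip T (P i) (ps j) = 0" if "j < k" "j \<noteq> i" for j
    proof (cases "j < i")
      case True
      then show ?thesis using P(3)[OF i, of "P j"] P(1)[OF that(1)]
        by (simp add: ps_def weighted_ip_smult)
    next
      case False
      then show ?thesis using P(3)[OF that(1), of "P i"] P(1)[OF i] that(2)
        by (simp add: ps_def weighted_ip_smult weighted_ip_commute[of T "P i"])
    qed
    then have "(\<Sum>j\<in>{..<k} - {i}. weighted_ip T (P i) (ps j)) = 0"
      by (intro sum.neutral ballI) simp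
    then have "(\<Sum>j<k. weighted_ip T (P i) (ps j)) = weighted_ip T (P i) (ps i)"
      using sum.remove[of "{..<k}" i "\<lambda>j. weighted_ip T (P i) (ps j)"] i by simp
    also have "\<dots> = weighted_ip T (monom 1 k) (P i)"
      using weighted_ip_self_neq_0[OF T nz] by (simp add: ps_def weighted_ip_smult)
    also have "\<dots> = weighted_ip T (P i) (monom 1 k)"
      by (rule weighted_ip_commute)
    finally have "weighted_ip T (P i) Q = 0"
      by (simp add: Q_def weighted_ip_diff weighted_ip_sum)
    then show ?thesis by (simp add: weighted_ip_commute)
  qed
  \<comment> \<open>Orthogonality to all \<open>P i\<close> extends to their span. The hypothesis is
    stated through vanishing coefficients instead of a degree bound, so that \<open>q = 0\<close> is
    the case \<open>j = 0\<close>; subtracting a multiple of the monic \<open>P j\<close> removes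
    the top coefficient.\<close>
  have "weighted_ip T Q q = 0" if "\<forall>i\<ge>j. coeff q i = 0" "j \<le> k" for q j
    using that
  proof (induction j arbitrary: q)
    case 0
    then have "q = 0" by (auto intro: poly_eqI)
    then show ?case by (simp add: weighted_ip_0)
  next
    case (Suc j)
    define q' where "q' = q - smult (coeff q j) (P j)"
    have "coeff q' i = 0" if "i \<ge> j" for i
    proof (cases "i = j")
      case True
      then show ?thesis using P(1,2)[of j] Suc.prems by (simp add: q'_def)
    next
      case False
      then show ?thesis using P(1)[of j] Suc.prems that by (simp add: q'_def coeff_eq_0)
    qed
    then have "weighted_ip T Q q' = 0" using Suc by simp
    then show ?case
      using orth[of j] Suc.prems by (simp add: q'_def weighted_ip_diff weighted_ip_smult)
  qed
  then have "weighted_ip T Q q = 0" if "degree q < k" for q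
    using that by (meson coeff_eq_0 le_less_trans less_le_trans not_le order_refl)
  then show ?case using degQ coeffQ by auto
qed

text \<open>\<open>P - monom 1 k\<close> has degree below \<open>k\<close> or is 0, so this product
  equals that of \<open>P\<close> with itself. It is the first nonvanishing moment of
  \<open>P\<close>.\<close>

lemma orthogonal_polynomial_monom:
  assumes T: "T > 0" and P: "degree P = k" "lead_coeff P = 1"
    and orth: "\<And>q. degree q < k \<Longrightarrow> weighted_ip T P q = 0"
  shows "weighted_ip T P (monom 1 k) \<noteq> 0"
proof -
  have "weighted_ip T P (P - monom 1 k) = 0"
  proof (cases "P - monom 1 k = 0")
    case False
    have "coeff (P - monom 1 k) i = 0" if "i \<ge> k" for i
      using that P by (cases "i = k") (auto simp: coeff_eq_0)
    then have "degree (P - monom 1 k) < k"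
      using False leading_coeff_neq_0 by (metis not_le)
    then show ?thesis by (rule orth)
  qed (simp add: weighted_ip_0)
  then have "weighted_ip T P (monom 1 k) = weighted_ip T P P"
    by (simp add: weighted_ip_diff)
  moreover have "P \<noteq> 0" using P(2) by auto
  ultimately show ?thesis using weighted_ip_self_neq_0[OF T] by simp
qed

section \<open>Behaviour of the Melnikov functions as z tends to 0\<close>

lemma powser_remainder_bound:
  fixes f :: "real \<Rightarrow> real"
  assumes sums: "\<And>x. \<bar>x\<bar> < 1 \<Longrightarrow> (\<lambda>n. c n * x ^ n) sums f x"
  shows "\<exists>C>0. \<forall>x. \<bar>x\<bar> \<le> 1 / 2 \<longrightarrow> \<bar>f x - (\<Sum>n<k. c n * x ^ n)\<bar> \<le> C * \<bar>x\<bar> ^ k"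
proof -
  \<comment> \<open>The remainder divided by \<open>x ^ k\<close>, again a power series; its
    continuity on a compact interval provides the constant.\<close>
  define g where "g x = (\<Sum>n. c (n + k) * x ^ n)" for x
  have summ: "summable (\<lambda>n. c (n + k) * x ^ n)" if "\<bar>x\<bar> < 1" for x
  proof -
    \<comment> \<open>The shifted series arises by dividing by a k-th power, which is impossible at
      \<open>x = 0\<close>; hence the detour through a positive point strictly between |x| and
      1.\<close>
    define y where "y = (\<bar>x\<bar> + 1) / 2"
    have y: "\<bar>x\<bar> < y" "0 < y" "y < 1" using that by (auto simp: y_def)
    then have "summable (\<lambda>n. c n * y ^ n)" using sums[of y] by (auto intro: sums_summable)
    then have "summable (\<lambda>n. c (n + k) * y ^ (n + k))" by (subst summable_iff_shift)
    then have "summable (\<lambda>n. c (n + k) * y ^ (n + k) * inverse (y ^ k))" by (rule summable_mult2)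
    moreover have "c (n + k) * y ^ (n + k) * inverse (y ^ k) = c (n + k) * y ^ n" for n
      using y by (simp add: power_add)
    ultimately have "summable (\<lambda>n. c (n + k) * y ^ n)" by simp
    then show ?thesis by (rule powser_inside) (use y in simp)
  qed
  have "continuous_on {-1/2..1/2} g"
  proof (intro continuous_at_imp_continuous_on ballI)
    fix x :: real assume "x \<in> {-1/2..1/2}"
    then show "isCont g x"
      unfolding g_def[abs_def] using summ[of "3/4"] by (intro isCont_powser[of _ "3/4"]) auto
  qed
  then obtain C where C: "C > 0" "\<And>x. x \<in> {-1/2..1/2} \<Longrightarrow> \<bar>g x\<bar> \<le> C"
    using continuous_on_Icc_bounded by blast
  have "\<bar>f x - (\<Sum>n<k. c n * x ^ n)\<bar> \<le> C * \<bar>x\<bar> ^ k" if x: "\<bar>x\<bar> \<le> 1 / 2" for x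
  proof -
    have s: "(\<lambda>n. c n * x ^ n) sums f x" using sums x by simp
    have "f x - (\<Sum>n<k. c n * x ^ n) = (\<Sum>n. c (n + k) * x ^ (n + k))"
      using suminf_split_initial_segment[OF sums_summable[OF s], of k] sums_unique[OF s] by simp
    also have "\<dots> = (\<Sum>n. x ^ k * (c (n + k) * x ^ n))"
      by (simp add: power_add mult_ac)
    also have "\<dots> = x ^ k * g x"
      unfolding g_def using summ[of x] x by (intro suminf_mult) auto
    finally have "\<bar>f x - (\<Sum>n<k. c n * x ^ n)\<bar> = \<bar>g x\<bar> * \<bar>x\<bar> ^ k"
      by (simp add: abs_mult power_abs)
    moreover have "x \<in> {-1/2..1/2}" using x by auto
    ultimately show ?thesis
      using C(2)[of x] by (simp add: mult_right_mono)
  qed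
  with C(1) show ?thesis by blast
qed

lemma inverse_sqrt_taylor:
  "\<exists>C>0. \<forall>x. \<bar>x\<bar> \<le> 1 / 2 \<longrightarrow>
     \<bar>1 / sqrt (1 + x) - (\<Sum>n<k. ((-1/2::real) gchoose n) * x ^ n)\<bar> \<le> C * \<bar>x\<bar> ^ k"
proof (rule powser_remainder_bound)
  fix x :: real assume x: "\<bar>x\<bar> < 1"
  have "(1 + x) powr (-1/2) = (1 + x) powr (- (1/2))"
    by (simp only: minus_divide_left)
  also have "\<dots> = 1 / (1 + x) powr (1/2)"
    by (rule powr_minus_divide)
  also have "(1 + x) powr (1/2) = sqrt (1 + x)"
    using x by (intro powr_half_sqrt) linarith
  finally show "(\<lambda>n. ((-1/2::real) gchoose n) * x ^ n) sums (1 / sqrt (1 + x))"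
    using gen_binomial_real[OF x, of "-1/2"] by (simp only:)
qed

text \<open>All factors -1/2 - i are negative. Hence no Taylor coefficient of
  \<open>1 / sqrt (1 + x)\<close> is missing, and the orders in \<open>z\<close> found below are
  exact.\<close>

lemma gbinomial_minus_half_neq_0: "((-1/2::real) gchoose k) \<noteq> 0"
proof -
  have "(-1/2::real) - of_nat i \<noteq> 0" for i
    using of_nat_0_le_iff[of i, where 'a = real] by linarith
  then show ?thesis
    unfolding gbinomial_prod_rev by auto
qed

lemma tendsto_at_right_0_linear_bound:
  fixes f :: "real \<Rightarrow> real"
  assumes "e > 0" "\<And>z. 0 < z \<Longrightarrow> z < e \<Longrightarrow> \<bar>f z - l\<bar> \<le> C * z"
  shows "(f \<longlongrightarrow> l) (at_right 0)"
proof -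
  have "((\<lambda>z. f z - l) \<longlongrightarrow> 0) (at_right 0)"
  proof (rule Lim_null_comparison)
    show "\<forall>\<^sub>F z in at_right 0. norm (f z - l) \<le> C * z"
      using assms unfolding eventually_at_right_field by auto
    show "((\<lambda>z. C * z) \<longlongrightarrow> 0) (at_right 0)"
      by (auto intro!: tendsto_eq_intros)
  qed
  then show ?thesis by (rule LIM_zero_cancel)
qed

lemma weight_bounds:
  assumes "t \<in> {-T..T}"
  shows "0 \<le> poly (weight T) t" "poly (weight T) t \<le> T\<^sup>2"
  using weight_nonneg[OF assms] by (auto simp: poly_weight)

lemma one_plus_weight_ge_1: "t \<in> {-T..T} \<Longrightarrow> 0 \<le> z \<Longrightarrow> 1 \<le> 1 + z * poly (weight T) t"
  using weight_nonneg[of t T] by simp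

lemma continuous_melnikov_integrand:
  assumes "0 \<le> z"
  shows "continuous_on {-T..T} (melnikov_integrand T \<beta> p z)"
  unfolding melnikov_integrand_def Let_def
  by (intro continuous_intros) (use one_plus_weight_ge_1[OF _ assms] in force)

lemma melnikov_add:
  assumes "0 \<le> z"
  shows "melnikov T (a + b) (p + q) z = melnikov T a p z + melnikov T b q z"
proof -
  have "melnikov_integrand T (a + b) (p + q) z =
      (\<lambda>t. melnikov_integrand T a p z t + melnikov_integrand T b q z t)"
    by (rule ext) (simp add: melnikov_integrand_def Let_def algebra_simps add_divide_distrib)
  then show ?thesis
    unfolding melnikov_def
    by (simp add: integral_add integrable_continuous_real continuous_melnikov_integrand assms)
qed

lemma melnikov_smult: "melnikov T (c * a) (smult c p) z = c * melnikov T a p z"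
proof -
  have "melnikov_integrand T (c * a) (smult c p) z = (\<lambda>t. c * melnikov_integrand T a p z t)"
    by (rule ext) (simp add: melnikov_integrand_def Let_def algebra_simps)
  then show ?thesis unfolding melnikov_def by (simp add: integral_mult_right)
qed

text \<open>\<open>melnikov\<close> is linear in the pair (\<beta>, p), so a combination of the
  basis functions is again the Melnikov function of one such pair.\<close>

lemma melnikov_combination:
  assumes "0 \<le> z"
  shows "c 0 * melnikov T 1 0 z + (\<Sum>k<K. c (Suc k) * melnikov T 0 (P k) z) =
    melnikov T (c 0) (\<Sum>k<K. smult (c (Suc k)) (P k)) z"
proof (induction K)
  case 0
  then show ?case using melnikov_smult[of T "c 0" 1 0 z] by simp
next
  case (Suc K)
  then show ?case
    using melnikov_add[OF assms, of T "c 0" 0 "\<Sum>k<K. smult (c (Suc k)) (P k)" "smult (c (Suc K)) (P K)"]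
      melnikov_smult[of T "c (Suc K)" 0 "P K" z]
    by simp
qed

lemma melnikov_const_tendsto:
  assumes T: "T > 0"
  shows "(melnikov T 1 0 \<longlongrightarrow> 2 * T) (at_right 0)"
proof (rule tendsto_at_right_0_linear_bound[OF zero_less_one])
  fix z :: real assume z: "0 < z"
  have int: "melnikov_integrand T 1 0 z integrable_on {-T..T}"
    using z by (intro integrable_continuous_real continuous_melnikov_integrand) simp
  have "\<bar>melnikov T 1 0 z - 2 * T\<bar> = norm (integral {-T..T} (\<lambda>t. melnikov_integrand T 1 0 z t - 1))"
    unfolding melnikov_def by (subst integral_diff[OF int]) (use T in auto)
  also have "\<dots> \<le> (z * T\<^sup>2) * (T - - T)"
  proof (rule integral_bound)
    fix t assume t: "t \<in> {-T..T}"
    note w = weight_bounds[OF t]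
    have "\<bar>sqrt (1 + z * poly (weight T) t) - sqrt 1\<bar> \<le> \<bar>z * poly (weight T) t\<bar>"
      using w z by (intro sqrt_lipschitz) auto
    also have "\<dots> \<le> z * T\<^sup>2" using w z by (simp add: abs_mult)
    finally show "norm (melnikov_integrand T 1 0 z t - 1) \<le> z * T\<^sup>2"
      by (simp add: melnikov_integrand_def Let_def)
  next
    show "continuous_on {-T..T} (\<lambda>t. melnikov_integrand T 1 0 z t - 1)"
      using z by (intro continuous_intros continuous_melnikov_integrand) simp
  qed (use T in simp)
  finally show "\<bar>melnikov T 1 0 z - 2 * T\<bar> \<le> (2 * T * T\<^sup>2) * z" by (simp add: mult_ac)
qed

text \<open>Expand \<open>1 / sqrt (1 + z w)\<close> in powers of \<open>z w\<close>: orthogonality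
  kills the moments of order below \<open>k\<close>, so the k-th one leads. The factor
  \<open>z\<close> in front of the integral raises the order to \<open>k + 1\<close>.\<close>

lemma melnikov_orthogonal_tendsto:
  assumes T: "T > 0" and orth: "\<And>q. degree q < k \<Longrightarrow> weighted_ip T P q = 0"
  shows "((\<lambda>z. melnikov T 0 P z / z ^ Suc k) \<longlongrightarrow>
    ((-1/2) gchoose k) * weighted_ip T P (monom 1 k)) (at_right 0)"
proof -
  let ?S = "{-T..T}"
  define w where "w = poly (weight T)"
  define u where "u t = t\<^sup>2 * w t * poly P (w t)" for t
  define a where "a n = ((-1/2::real) gchoose n)" for n
  define m where "m = weighted_ip T P (monom 1 k)"
  have contw: "continuous_on ?S w" unfolding w_def by (intro continuous_intros)
  have contu: "continuous_on ?S u" unfolding u_def w_def by (intro continuous_intros)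
  obtain K where K: "K > 0" "\<And>t. t \<in> ?S \<Longrightarrow> \<bar>u t\<bar> \<le> K"
    using continuous_on_Icc_bounded[OF contu] by blast
  obtain C where C: "C > 0"
    "\<And>x. \<bar>x\<bar> \<le> 1 / 2 \<Longrightarrow> \<bar>1 / sqrt (1 + x) - (\<Sum>n<Suc k. a n * x ^ n)\<bar> \<le> C * \<bar>x\<bar> ^ Suc k"
    using inverse_sqrt_taylor[of "Suc k"] unfolding a_def by blast
  define D where "D = K * C * (T\<^sup>2) ^ Suc k * (2 * T)"
  have ip: "integral ?S (\<lambda>t. u t * w t ^ n) = weighted_ip T P (monom 1 n)" for n
    by (simp add: weighted_ip_def u_def w_def poly_monom)
  show ?thesis
    unfolding a_def[symmetric] m_def[symmetric]
  proof (rule tendsto_at_right_0_linear_bound)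
    \<comment> \<open>In this range \<open>z * w \<le> 1 / 2\<close> on the whole interval, where
      the Taylor estimate is available.\<close>
    show "0 < 1 / (2 * T\<^sup>2)" using T by simp
    fix z :: real assume z: "0 < z" "z < 1 / (2 * T\<^sup>2)"
    have zT: "z * T\<^sup>2 \<le> 1 / 2" using z(2) T by (simp add: field_simps)
    have zw: "\<bar>z * w t\<bar> \<le> z * T\<^sup>2" if "t \<in> ?S" for t
      using weight_bounds[OF that] z(1) by (simp add: w_def abs_mult)
    have y1: "1 \<le> 1 + z * w t" if "t \<in> ?S" for t
      unfolding w_def using one_plus_weight_ge_1[OF that] z(1) by simp
    have cont: "continuous_on ?S (\<lambda>t. u t * (1 / sqrt (1 + z * w t)))"
      "continuous_on ?S (\<lambda>t. u t * (\<Sum>n<Suc k. a n * (z * w t) ^ n))"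
      by (intro continuous_intros contu contw; use y1 in force)+
    have "(\<Sum>n<Suc k. a n * z ^ n * integral ?S (\<lambda>t. u t * w t ^ n)) = a k * z ^ k * m"
    proof -
      have "a n * z ^ n * integral ?S (\<lambda>t. u t * w t ^ n) = 0" if "n < k" for n
        using orth[of "monom 1 n"] that unfolding ip by (simp add: degree_monom_eq)
      then have "(\<Sum>n<k. a n * z ^ n * integral ?S (\<lambda>t. u t * w t ^ n)) = 0"
        by (intro sum.neutral ballI) simp
      then show ?thesis by (simp add: ip m_def)
    qed
    moreover have "integral ?S (\<lambda>t. u t * (\<Sum>n<Suc k. a n * (z * w t) ^ n)) =
        (\<Sum>n<Suc k. a n * z ^ n * integral ?S (\<lambda>t. u t * w t ^ n))"
    proof -
      have "integral ?S (\<lambda>t. u t * (\<Sum>n<Suc k. a n * (z * w t) ^ n)) =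
          integral ?S (\<lambda>t. \<Sum>n<Suc k. a n * z ^ n * (u t * w t ^ n))"
        by (intro arg_cong2[where f = integral] refl ext)
          (simp add: sum_distrib_left power_mult_distrib mult_ac del: sum.lessThan_Suc)
      also have "\<dots> = (\<Sum>n<Suc k. integral ?S (\<lambda>t. a n * z ^ n * (u t * w t ^ n)))"
        by (intro integral_sum integrable_continuous_real continuous_intros contu contw) simp
      finally show ?thesis by (simp only: integral_mult_right)
    qed
    ultimately have poly_part: "integral ?S (\<lambda>t. u t * (\<Sum>n<Suc k. a n * (z * w t) ^ n)) = a k * z ^ k * m"
      by simp
    have "melnikov_integrand T 0 P z = (\<lambda>t. z * (u t * (1 / sqrt (1 + z * w t))))"
      by (rule ext) (simp add: melnikov_integrand_def Let_def u_def w_def)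
    then have mel: "melnikov T 0 P z = z * integral ?S (\<lambda>t. u t * (1 / sqrt (1 + z * w t)))"
      unfolding melnikov_def by (simp only: integral_mult_right)
    have "\<bar>integral ?S (\<lambda>t. u t * (1 / sqrt (1 + z * w t))) - a k * z ^ k * m\<bar> =
       norm (integral ?S (\<lambda>t. u t * (1 / sqrt (1 + z * w t)) - u t * (\<Sum>n<Suc k. a n * (z * w t) ^ n)))"
      unfolding poly_part[symmetric]
      by (subst integral_diff) (use cont in \<open>simp_all only: integrable_continuous_real real_norm_def\<close>)
    also have "\<dots> \<le> K * (C * (z * T\<^sup>2) ^ Suc k) * (T - - T)"
    proof (rule integral_bound)
      show "- T \<le> T" using T by simp
      show "continuous_on ?S (\<lambda>t. u t * (1 / sqrt (1 + z * w t)) - u t * (\<Sum>n<Suc k. a n * (z * w t) ^ n))"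
        using cont by (rule continuous_on_diff)
      fix t assume t: "t \<in> ?S"
      have "\<bar>1 / sqrt (1 + z * w t) - (\<Sum>n<Suc k. a n * (z * w t) ^ n)\<bar> \<le> C * \<bar>z * w t\<bar> ^ Suc k"
        using zw[OF t] zT by (intro C(2)) linarith
      also have "\<dots> \<le> C * (z * T\<^sup>2) ^ Suc k"
        using zw[OF t] C(1) by (intro mult_left_mono power_mono) auto
      finally have "\<bar>u t\<bar> * \<bar>1 / sqrt (1 + z * w t) - (\<Sum>n<Suc k. a n * (z * w t) ^ n)\<bar> \<le>
          K * (C * (z * T\<^sup>2) ^ Suc k)"
        using K(1) K(2)[OF t] by (intro mult_mono) auto
      then show "norm (u t * (1 / sqrt (1 + z * w t)) - u t * (\<Sum>n<Suc k. a n * (z * w t) ^ n)) \<le>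
          K * (C * (z * T\<^sup>2) ^ Suc k)"
        by (simp only: real_norm_def right_diff_distrib[symmetric] abs_mult)
    qed
    also have "\<dots> = D * z ^ Suc k"
      by (simp add: D_def power_mult_distrib mult_ac)
    finally have bound: "\<bar>integral ?S (\<lambda>t. u t * (1 / sqrt (1 + z * w t))) - a k * z ^ k * m\<bar> \<le> D * z ^ Suc k" .
    have "melnikov T 0 P z / z ^ Suc k - a k * m =
        (integral ?S (\<lambda>t. u t * (1 / sqrt (1 + z * w t))) - a k * z ^ k * m) / z ^ k"
      unfolding mel using z(1) by (simp add: field_simps)
    then have "\<bar>melnikov T 0 P z / z ^ Suc k - a k * m\<bar> =
        \<bar>integral ?S (\<lambda>t. u t * (1 / sqrt (1 + z * w t))) - a k * z ^ k * m\<bar> / z ^ k"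
      using z(1) by simp
    also have "\<dots> \<le> D * z ^ Suc k / z ^ k"
      using bound z(1) by (intro divide_right_mono) auto
    also have "\<dots> = D * z" using z(1) by simp
    finally show "\<bar>melnikov T 0 P z / z ^ Suc k - a k * m\<bar> \<le> D * z" .
  qed
qed

text \<open>For \<beta> < 0 the quotient of \<open>melnikov\<close> by \<open>sqrt z\<close> is
  nondecreasing in \<open>z\<close>: its integrand is
  \<open>\<beta> * sqrt (1/z + w) + q / sqrt (1/z + w)\<close> with \<open>q \<ge> 0\<close>, and
  \<open>1/z + w\<close> decreases. For \<beta> \<ge> 0 the integrand is nonnegative anyway.\<close>

lemma melnikov_nonneg_persists:
  assumes T: "T > 0" and p: "\<And>x. 0 \<le> poly p x" and z: "0 < z" "z < z'" and G: "0 < melnikov T \<beta> p z"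
  shows "0 \<le> melnikov T \<beta> p z'"
proof (cases "0 \<le> \<beta>")
  case True
  then show ?thesis
    unfolding melnikov_def melnikov_integrand_def Let_def
  proof (intro integral_nonneg)
    show "(\<lambda>t. \<beta> * sqrt (1 + z' * poly (weight T) t) + z' * (t\<^sup>2 * poly (weight T) t *
        poly p (poly (weight T) t)) / sqrt (1 + z' * poly (weight T) t)) integrable_on {-T..T}"
      using continuous_melnikov_integrand[of z' T \<beta> p] z
      unfolding melnikov_integrand_def Let_def by (intro integrable_continuous_real) simp
  qed (use p z True weight_nonneg in auto)
next
  case False
  have "sqrt z' * melnikov T \<beta> p z \<le> sqrt z * melnikov T \<beta> p z'"
    unfolding melnikov_def integral_mult_right[symmetric]
  proof (rule integral_le)
    show "(\<lambda>t. sqrt z' * melnikov_integrand T \<beta> p z t) integrable_on {-T..T}"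
      "(\<lambda>t. sqrt z * melnikov_integrand T \<beta> p z' t) integrable_on {-T..T}"
      using z by (intro integrable_continuous_real continuous_intros continuous_melnikov_integrand; simp)+
    fix t assume t: "t \<in> {-T..T}"
    define w where "w = poly (weight T) t"
    define q where "q = t\<^sup>2 * w * poly p w"
    have w: "0 \<le> w" using weight_nonneg[OF t] by (simp add: w_def)
    then have q: "0 \<le> q" using p by (simp add: q_def)
    \<comment> \<open>Under the roots this is just \<open>z \<le> z'\<close>, as the terms
      \<open>z * z' * w\<close> agree.\<close>
    have key: "sqrt z * sqrt (1 + z' * w) \<le> sqrt z' * sqrt (1 + z * w)"
      unfolding real_sqrt_mult[symmetric] using z by (simp add: algebra_simps)
    have pos: "0 < sqrt (1 + z * w)" "0 < sqrt (1 + z' * w)" "0 < sqrt z" "0 < sqrt z'"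
      using z w by (simp_all add: add_pos_nonneg)
    have sq: "z = sqrt z * sqrt z" "z' = sqrt z' * sqrt z'" using z by auto
    have "\<beta> * (sqrt z' * sqrt (1 + z * w)) \<le> \<beta> * (sqrt z * sqrt (1 + z' * w))"
      using key False by (intro mult_left_mono_neg) auto
    moreover have "sqrt z' * (z / sqrt (1 + z * w)) \<le> sqrt z * (z' / sqrt (1 + z' * w))"
    proof -
      have "(sqrt z * sqrt z') * (sqrt z * sqrt (1 + z' * w)) \<le> (sqrt z * sqrt z') * (sqrt z' * sqrt (1 + z * w))"
        using key pos by (intro mult_left_mono) auto
      moreover have "(sqrt z * sqrt z') * (sqrt z * sqrt (1 + z' * w)) = sqrt z' * (sqrt z * sqrt z) * sqrt (1 + z' * w)"
        "(sqrt z * sqrt z') * (sqrt z' * sqrt (1 + z * w)) = sqrt z * (sqrt z' * sqrt z') * sqrt (1 + z * w)"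
        by (simp_all only: mult_ac)
      ultimately have "sqrt z' * z * sqrt (1 + z' * w) \<le> sqrt z * z' * sqrt (1 + z * w)"
        unfolding sq[symmetric] by simp
      then show ?thesis using pos by (simp add: divide_simps mult_ac)
    qed
    then have "q * (sqrt z' * (z / sqrt (1 + z * w))) \<le> q * (sqrt z * (z' / sqrt (1 + z' * w)))"
      using q by (rule mult_left_mono)
    ultimately have "\<beta> * (sqrt z' * sqrt (1 + z * w)) + q * (sqrt z' * (z / sqrt (1 + z * w))) \<le>
        \<beta> * (sqrt z * sqrt (1 + z' * w)) + q * (sqrt z * (z' / sqrt (1 + z' * w)))"
      by (rule add_mono)
    then show "sqrt z' * melnikov_integrand T \<beta> p z t \<le> sqrt z * melnikov_integrand T \<beta> p z' t"
      unfolding melnikov_integrand_def Let_def w_def[symmetric] q_def[symmetric]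
      by (simp add: algebra_simps)
  qed
  moreover have "0 < sqrt z' * melnikov T \<beta> p z" using G z by simp
  ultimately have "0 < sqrt z * melnikov T \<beta> p z'" by linarith
  then show ?thesis using z by (simp add: zero_less_mult_iff)
qed

text \<open>A polynomial without real roots has constant sign. After replacing (\<beta>, p) by its
  negative if necessary, \<open>p\<close> is positive, and a positive value of
  \<open>melnikov\<close> can never be followed by a negative one; both patterns + - + and - + -
  contain such a descent.\<close>

lemma alternating_melnikov_root:
  assumes T: "T > 0" and z: "0 < z0" "z0 < z1" "z1 < z2"
    and s: "s = 1 \<or> s = -1"
    and G: "0 < s * melnikov T \<beta> p z0" "s * melnikov T \<beta> p z1 < 0" "0 < s * melnikov T \<beta> p z2"
  shows "\<exists>x. poly p x = 0"
proof (rule ccontr)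
  assume no_root: "\<nexists>x. poly p x = 0"
  have nonneg_case: False
    if q: "\<And>x. 0 \<le> poly q x" and s': "s' = 1 \<or> s' = -1"
      and G': "0 < s' * melnikov T b q z0" "s' * melnikov T b q z1 < 0" "0 < s' * melnikov T b q z2"
    for q b s'
    using s' melnikov_nonneg_persists[OF T q, of z0 z1 b] melnikov_nonneg_persists[OF T q, of z1 z2 b] z G'
    by auto
  have pos: "0 \<le> poly q x" if q: "\<nexists>x. poly q x = 0" "0 < poly q 0" for q :: "real poly" and x
  proof (rule ccontr)
    assume x: "\<not> 0 \<le> poly q x"
    with q have "x \<noteq> 0" by auto
    then consider "0 < x" | "x < 0" by linarith
    then show False
      using poly_IVT_neg[of 0 x q] poly_IVT_pos[of x 0 q] q x by cases auto
  qed
  show False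
  proof (cases "0 < poly p 0")
    case True
    then show False using nonneg_case[of p s \<beta>] pos[of p] no_root s G by blast
  next
    case False
    then have "poly p 0 \<noteq> 0" using no_root by blast
    with False have "0 < poly (- p) 0" by simp
    then have "0 \<le> poly (- p) x" for x
      using no_root by (intro pos) auto
    moreover have "melnikov T (- \<beta>) (- p) x = - melnikov T \<beta> p x" for x
      using melnikov_smult[of T "-1" \<beta> p x] by simp
    ultimately show False using nonneg_case[of "- p" "- s" "- \<beta>"] s G by auto
  qed
qed

section \<open>Sign changes and factorization\<close>

text \<open>
  Descartes-type construction: adding a small multiple of \<open>h\<^sub>j\<close>, which dominates \<open>h\<^sub>k\<close> for \<open>k > j\<close>
  near \<open>0\<close>, creates one more sign change to the left of the existing ones.
\<close>

lemma alternating_combination_exists: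
  fixes h :: "nat \<Rightarrow> real \<Rightarrow> real"
  assumes lim: "\<And>k. k \<le> K \<Longrightarrow> ((\<lambda>z. h k z / z ^ k) \<longlongrightarrow> l k) (at_right 0)"
    and l: "\<And>k. k \<le> K \<Longrightarrow> l k \<noteq> 0" and e: "e > 0"
  shows "\<exists>c z s. c K = (1::real) \<and> (s = 1 \<or> s = -1) \<and> (\<forall>i\<le>K. 0 < z i \<and> z i < e) \<and>
     (\<forall>i<K. z i < z (Suc i)) \<and> (\<forall>i\<le>K. 0 < s * (-1) ^ i * (\<Sum>k\<le>K. c k * h k (z i)))"
proof -
  \<comment> \<open>The induction runs from \<open>j = K\<close> downwards, adding the dominant
    functions last. Points and coefficients keep their final indices, and \<open>c K\<close> is
    never altered.\<close>
  have "\<exists>c z s. c K = (1::real) \<and> (s = 1 \<or> s = -1) \<and> (\<forall>i\<in>{j..K}. 0 < z i \<and> z i < e) \<and>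
     (\<forall>i\<in>{j..<K}. z i < z (Suc i)) \<and> (\<forall>i\<in>{j..K}. 0 < s * (-1) ^ i * (\<Sum>k=j..K. c k * h k (z i)))"
    if "j \<le> K" for j
    using that
  proof (induction j rule: inc_induct)
    case base
    have "\<forall>\<^sub>F z in at_right 0. h K z / z ^ K \<noteq> 0"
      by (rule tendsto_imp_eventually_ne[OF lim[OF order.refl] l[OF order.refl]])
    moreover have "\<forall>\<^sub>F z in at_right 0. z < e"
      using e unfolding eventually_at_right_field by blast
    ultimately have "\<forall>\<^sub>F z in at_right 0. h K z \<noteq> 0 \<and> 0 < z \<and> z < e"
      using eventually_at_right_less[of "0::real"] by eventually_elim auto
    then obtain z where z: "h K z \<noteq> 0" "0 < z" "z < e"
      by (auto dest!: eventually_happens)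
    define s where "s = sgn ((-1) ^ K * h K z)"
    have nz: "(-1) ^ K * h K z \<noteq> 0" using z(1) by simp
    then have s: "s = 1 \<or> s = -1" by (simp add: s_def sgn_if)
    have "s * ((-1) ^ K * h K z) = \<bar>(-1) ^ K * h K z\<bar>"
      unfolding s_def by (metis abs_sgn mult.commute)
    then have "0 < s * (-1) ^ K * h K z"
      using nz by (simp only: mult.assoc zero_less_abs_iff not_False_eq_True)
    then have pos: "0 < s * (-1) ^ K * (\<Sum>k=K..K. 1 * h k z)"
      by (simp only: atLeastAtMost_singleton sum.insert sum.empty finite.emptyI empty_iff simp_thms
          mult_1 add_0_right)
    show ?case
    proof (rule exI[of _ "\<lambda>_. 1"], rule exI[of _ "\<lambda>_. z"], rule exI[of _ s], intro conjI ballI)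
      show "(1::real) = 1" ..
      show "s = 1 \<or> s = -1" by (rule s)
    next
      fix i assume "i \<in> {K..K}"
      then have "i = K" by simp
      then show "0 < z" "z < e" "0 < s * (-1) ^ i * (\<Sum>k=K..K. 1 * h k z)"
        using z pos by blast+
    next
      fix i assume "i \<in> {K..<K}"
      then show "z < z" by simp
    qed
  next
    case (step n)
    from step.IH obtain c z s where c: "c K = (1::real)" and s: "s = 1 \<or> s = -1"
      and IH: "\<forall>i\<in>{Suc n..K}. 0 < z i \<and> z i < e" "\<forall>i\<in>{Suc n..<K}. z i < z (Suc i)"
        "\<forall>i\<in>{Suc n..K}. 0 < s * (-1) ^ i * (\<Sum>k=Suc n..K. c k * h k (z i))"
      by (elim exE conjE) (rule that)
    note z = bspec[OF IH(1)] and mono = bspec[OF IH(2)] and alt = bspec[OF IH(3)]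
    have nK: "n < K" "n \<le> K" using step by auto
    define H where "H x = (\<Sum>k=Suc n..K. c k * h k x)" for x
    \<comment> \<open>The sign that gives the new term \<open>\<tau> * \<sigma> * h n\<close> the
      sign \<open>s * (-1) ^ n\<close> near 0, one alternation to the left of
      \<open>z (Suc n)\<close>. A small \<tau> leaves the strict signs at the old points
      intact.\<close>
    define \<sigma> where "\<sigma> = s * (-1) ^ n * sgn (l n)"
    have "\<forall>\<^sub>F \<tau> in at_right 0. \<forall>i\<in>{Suc n..K}. 0 < s * (-1) ^ i * (\<tau> * \<sigma> * h n (z i) + H (z i))"
    proof (subst eventually_ball_finite_distrib, simp, intro ballI)
      fix i assume i: "i \<in> {Suc n..K}"
      have "((\<lambda>\<tau>. s * (-1) ^ i * (\<tau> * \<sigma> * h n (z i) + H (z i))) \<longlongrightarrow>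
          s * (-1) ^ i * (0 * \<sigma> * h n (z i) + H (z i))) (at_right 0)"
        by (intro tendsto_intros)
      then show "\<forall>\<^sub>F \<tau> in at_right 0. 0 < s * (-1) ^ i * (\<tau> * \<sigma> * h n (z i) + H (z i))"
        using alt[OF i] by (intro order_tendstoD(1)) (auto simp: H_def)
    qed
    then have "\<forall>\<^sub>F \<tau> in at_right 0. 0 < \<tau> \<and>
        (\<forall>i\<in>{Suc n..K}. 0 < s * (-1) ^ i * (\<tau> * \<sigma> * h n (z i) + H (z i)))"
      using eventually_at_right_less[of "0::real"] by eventually_elim auto
    then obtain \<tau> where \<tau>: "0 < \<tau>"
      "\<And>i. i \<in> {Suc n..K} \<Longrightarrow> 0 < s * (-1) ^ i * (\<tau> * \<sigma> * h n (z i) + H (z i))"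
      by (auto dest!: eventually_happens)
    \<comment> \<open>The old combination contains only orders above \<open>n\<close>, so near 0 the
      new term prevails however small \<tau> is.\<close>
    have H0: "((\<lambda>x. H x / x ^ n) \<longlongrightarrow> 0) (at_right 0)"
    proof -
      have "((\<lambda>x. \<Sum>k=Suc n..K. c k * (h k x / x ^ k * x ^ (k - n))) \<longlongrightarrow>
          (\<Sum>k=Suc n..K. c k * (l k * 0 ^ (k - n)))) (at_right 0)"
        by (intro tendsto_intros lim) auto
      also have "(\<Sum>k=Suc n..K. c k * (l k * 0 ^ (k - n))) = 0"
        by (intro sum.neutral) (auto simp: power_0_left)
      finally show ?thesis
      proof (rule Lim_transform_eventually)
        show "\<forall>\<^sub>F x in at_right 0. (\<Sum>k=Suc n..K. c k * (h k x / x ^ k * x ^ (k - n))) = H x / x ^ n"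
          using eventually_at_right_less[of "0::real"]
        proof eventually_elim
          case (elim x)
          have "c k * (h k x / x ^ k * x ^ (k - n)) = c k * h k x / x ^ n" if "k \<in> {Suc n..K}" for k
          proof -
            have "x ^ k = x ^ (k - n) * x ^ n" using that by (simp add: power_add[symmetric])
            then show ?thesis using elim by (simp add: field_simps)
          qed
          then show ?case unfolding H_def sum_divide_distrib by (rule sum.cong[OF refl])
        qed
      qed
    qed
    have lim': "((\<lambda>x. s * (-1) ^ n * (\<tau> * \<sigma> * (h n x / x ^ n) + H x / x ^ n)) \<longlongrightarrow>
        s * (-1) ^ n * (\<tau> * \<sigma> * l n + 0)) (at_right 0)"
      by (intro tendsto_intros lim H0 nK)
    have val: "s * (-1) ^ n * (\<tau> * \<sigma> * l n + 0) = \<tau> * \<bar>l n\<bar>"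
    proof -
      have "s * s = 1" using s by auto
      moreover have "(-1) ^ n * (-1) ^ n = (1::real)" by (simp add: power_mult_distrib[symmetric])
      ultimately have "(s * s) * ((-1) ^ n * (-1) ^ n) = 1" by simp
      moreover have "s * (-1) ^ n * (\<tau> * \<sigma> * l n + 0) =
          (s * s) * ((-1) ^ n * (-1) ^ n) * (\<tau> * (sgn (l n) * l n))"
        by (simp add: \<sigma>_def mult_ac)
      ultimately show ?thesis by (simp add: sgn_mult_self_eq abs_sgn mult.commute)
    qed
    have "0 < \<tau> * \<bar>l n\<bar>" using \<tau>(1) l[of n] nK by simp
    then have "\<forall>\<^sub>F x in at_right 0. 0 < s * (-1) ^ n * (\<tau> * \<sigma> * (h n x / x ^ n) + H x / x ^ n)"
      by (rule order_tendstoD(1)[OF lim'[unfolded val]])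
    moreover have "\<forall>\<^sub>F x in at_right 0. x < z (Suc n)"
      using z[of "Suc n"] nK unfolding eventually_at_right_field by auto
    ultimately have "\<forall>\<^sub>F x in at_right 0. 0 < x \<and> x < z (Suc n) \<and>
        0 < s * (-1) ^ n * (\<tau> * \<sigma> * h n x + H x)"
      using eventually_at_right_less[of "0::real"]
    proof eventually_elim
      case (elim x)
      have eq: "s * (-1) ^ n * (\<tau> * \<sigma> * h n x + H x) =
          x ^ n * (s * (-1) ^ n * (\<tau> * \<sigma> * (h n x / x ^ n) + H x / x ^ n))"
        using elim by (simp add: field_simps)
      have "0 < x ^ n" using elim by simp
      with elim show ?case unfolding eq by (intro conjI mult_pos_pos[of "x ^ n"]) assumption+
    qed
    then obtain x where x: "0 < x" "x < z (Suc n)" "0 < s * (-1) ^ n * (\<tau> * \<sigma> * h n x + H x)"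
      by (auto dest!: eventually_happens)
    define c' where "c' = c(n := \<tau> * \<sigma>)"
    define z' where "z' = z(n := x)"
    have sum': "(\<Sum>k=n..K. c' k * h k y) = \<tau> * \<sigma> * h n y + H y" for y
      using nK by (subst sum.atLeast_Suc_atMost) (auto simp: c'_def H_def intro!: sum.cong)
    have "x < e" using z[of "Suc n"] x nK by simp
    have "c' K = 1" using c nK by (simp add: c'_def)
    moreover have "\<forall>i\<in>{n..K}. 0 < z' i \<and> z' i < e"
      using z x \<open>x < e\<close> by (auto simp: z'_def)
    moreover have "\<forall>i\<in>{n..<K}. z' i < z' (Suc i)"
      using mono x by (auto simp: z'_def)
    moreover have "\<forall>i\<in>{n..K}. 0 < s * (-1) ^ i * (\<Sum>k=n..K. c' k * h k (z' i))"
      unfolding sum' using \<tau>(2) x(3) by (auto simp: z'_def)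
    ultimately show ?case using s by blast
  qed
  from this[of 0] show ?thesis
    by (simp add: atLeast0AtMost atLeast0LessThan Ball_def)
qed

text \<open>One zero per gap by the intermediate value theorem; strictness at the sample points
  makes the zeros distinct.\<close>

lemma zeros_of_alternation:
  fixes f x :: "_ \<Rightarrow> real" and s :: real
  assumes cont: "continuous_on {x 0..x K} f"
    and mono: "\<And>i. i < K \<Longrightarrow> x i < x (Suc i)"
    and alt: "\<And>i. i \<le> K \<Longrightarrow> 0 < s * (-1) ^ i * f (x i)"
  shows "\<exists>R. finite R \<and> card R = K \<and> (\<forall>r\<in>R. x 0 < r \<and> r < x K \<and> f r = 0)"
  using assms
proof (induction K)
  case 0
  then show ?case by (intro exI[of _ "{}"]) simp
next
  case (Suc K)
  have le: "x 0 \<le> x K"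
  proof -
    have "x 0 \<le> x k" if "k \<le> K" for k
      using that
    proof (induction k)
      case (Suc k)
      then show ?case using Suc.prems Suc.IH \<open>\<And>i. i < Suc K \<Longrightarrow> x i < x (Suc i)\<close>[of k] by linarith
    qed simp
    then show ?thesis by simp
  qed
  have lt: "x K < x (Suc K)" using Suc.prems(2) by simp
  obtain R where R: "finite R" "card R = K" "\<And>r. r \<in> R \<Longrightarrow> x 0 < r \<and> r < x K \<and> f r = 0"
  proof -
    have "continuous_on {x 0..x K} f"
      using Suc.prems(1) lt by (rule_tac continuous_on_subset) auto
    from Suc.IH[OF this] Suc.prems(2,3) that show ?thesis by auto
  qed
  define g where "g y = s * (-1) ^ K * f y" for y
  have "continuous_on {x K..x (Suc K)} g"
    unfolding g_def using Suc.prems(1) le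
    by (intro continuous_intros) (rule continuous_on_subset, auto)
  moreover have "0 < g (x K)" "g (x (Suc K)) < 0"
    using Suc.prems(3)[of K] Suc.prems(3)[of "Suc K"] by (auto simp: g_def)
  ultimately obtain y where y: "x K \<le> y" "y \<le> x (Suc K)" "g y = 0"
    using IVT2'[of g "x (Suc K)" 0 "x K"] lt by auto
  have "s \<noteq> 0" using Suc.prems(3)[of 0] by auto
  with y have "f y = 0" by (simp add: g_def)
  moreover have "y \<noteq> x K" "y \<noteq> x (Suc K)" using y \<open>0 < g (x K)\<close> \<open>g (x (Suc K)) < 0\<close> by auto
  ultimately have y': "x K < y" "y < x (Suc K)" "f y = 0" using y by auto
  have "y \<notin> R" using R(3) y' by force
  then show ?case
    using R y' le lt by (intro exI[of _ "insert y R"]) (auto intro: less_trans dest: R(3))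
qed

section \<open>Real factors of prescribed degree\<close>

lemma quadratic_dvd_of_complex_root:
  fixes p :: "real poly"
  assumes root: "poly (map_poly of_real p) z = 0" and z: "Im z \<noteq> 0"
  shows "[:(Re z)\<^sup>2 + (Im z)\<^sup>2, - 2 * Re z, 1:] dvd p"
proof -
  define q where "q = [:(Re z)\<^sup>2 + (Im z)\<^sup>2, - 2 * Re z, 1:]"
  define s where "s = p mod q"
  have q: "q \<noteq> 0" "degree q = 2" by (auto simp: q_def)
  have hom: "map_poly complex_of_real (u * v + w) =
      map_poly of_real u * map_poly of_real v + map_poly of_real w" for u v w
    by (rule poly_eqI) (simp add: coeff_map_poly coeff_mult)
  have qz: "poly (map_poly of_real q) z = 0"
    by (simp add: q_def map_poly_pCons complex_eq_iff algebra_simps power2_eq_square)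
  have "p = (p div q) * q + s" by (simp add: s_def)
  then have sz: "poly (map_poly of_real s) z = 0"
    using root qz hom[of "p div q" q s] by (metis add_0 mult_zero_right poly_add poly_mult)
  have "degree s < 2 \<or> s = 0"
    using degree_mod_less[OF q(1), of p] q(2) by (auto simp: s_def)
  \<comment> \<open>The remainder modulo the quadratic with roots \<open>z\<close> and its conjugate
    has degree at most 1 and real coefficients; a nonreal root forces both of them to be 0.\<close>
  then have "s = [:coeff s 0, coeff s 1:]"
    by (intro poly_eqI) (auto simp: coeff_pCons coeff_eq_0 split: nat.split)
  then obtain a b where s: "s = [:a, b:]" by blast
  have "of_real a + z * of_real b = 0"
    using sz by (simp add: s map_poly_pCons)
  then have "s = 0"
    using z by (auto simp: s complex_eq_iff)
  then show ?thesis by (simp add: s_def q_def mod_eq_0_iff_dvd)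
qed

lemma real_poly_quadratic_dvd:
  fixes p :: "real poly"
  assumes "2 \<le> degree p"
  shows "\<exists>q. q dvd p \<and> degree q = 2"
proof -
  \<comment> \<open>A nonreal root yields a quadratic factor at once. Otherwise a real root is
    divided out and the quotient treated likewise, the product of two linear factors being the
    second way to reach degree 2.\<close>
  have root: "(\<exists>q. q dvd p \<and> degree q = 2) \<or> (\<exists>a. poly p a = 0)"
    if "1 \<le> degree p" for p :: "real poly"
  proof -
    have "degree (map_poly complex_of_real p) = degree p"
      by (rule degree_map_poly) simp
    then have "\<not> constant (poly (map_poly complex_of_real p))"
      using that by (simp add: constant_degree)
    then obtain z where z: "poly (map_poly complex_of_real p) z = 0"
      using fundamental_theorem_of_algebra by blast
    show ?thesis
    proof (cases "Im z = 0")
      case True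
      then have "complex_of_real (poly p (Re z)) = 0"
        using z complex_poly_of_real[of p "Re z"] by (simp add: complex_is_Real_iff of_real_Re)
      then show ?thesis by auto
    next
      case False
      then show ?thesis
        using quadratic_dvd_of_complex_root[OF z] by (intro disjI1 exI conjI) auto
    qed
  qed
  show ?thesis
  proof (cases "\<exists>a. poly p a = 0")
    case True
    then obtain a p' where p: "p = [:-a, 1:] * p'"
      by (auto simp: poly_eq_0_iff_dvd elim: dvdE)
    have "p' \<noteq> 0" using assms p by auto
    then have "degree p = Suc (degree p')" unfolding p by (subst degree_mult_eq) auto
    then have "1 \<le> degree p'" using assms by simp
    from root[OF this] show ?thesis
    proof
      assume "\<exists>q. q dvd p' \<and> degree q = 2"
      then show ?thesis using p dvd_mult by blast
    next
      assume "\<exists>b. poly p' b = 0"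
      then obtain b where "[:-b, 1:] dvd p'" by (auto simp: poly_eq_0_iff_dvd)
      then have "[:-a, 1:] * [:-b, 1:] dvd p" unfolding p by (rule mult_dvd_mono[OF dvd_refl])
      then show ?thesis by (intro exI conjI) auto
    qed
  qed (use root[of p] assms in auto)
qed

lemma real_poly_even_degree_dvd:
  fixes p :: "real poly"
  assumes "2 * k \<le> degree p"
  shows "\<exists>q. q dvd p \<and> degree q = 2 * k"
  using assms
proof (induction k arbitrary: p)
  case 0
  then show ?case by (intro exI[of _ 1]) auto
next
  case (Suc k)
  then obtain q p' where q: "degree q = 2" and p: "p = q * p'"
    using real_poly_quadratic_dvd[of p] by (auto simp: dvd_def)
  have nz: "p' \<noteq> 0" "q \<noteq> 0" using Suc.prems p q by auto
  then have "degree p = 2 + degree p'" unfolding p using q by (simp add: degree_mult_eq)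
  then have "2 * k \<le> degree p'" using Suc.prems by simp
  from Suc.IH[OF this] obtain q' where q': "q' dvd p'" "degree q' = 2 * k" by blast
  moreover have "q' \<noteq> 0" using q'(1) nz by auto
  ultimately show ?case
    using q nz p by (intro exI[of _ "q * q'"]) (auto simp: degree_mult_eq)
qed

lemma real_poly_split_even:
  fixes p :: "real poly"
  assumes "degree p = 2 * k + e"
  shows "\<exists>p1 p2. p = p1 * p2 \<and> degree p1 = 2 * k \<and> degree p2 = e"
proof (cases "p = 0")
  case True
  then show ?thesis using assms by (intro exI[of _ 0]) auto
next
  case False
  obtain p1 p2 where p: "p = p1 * p2" "degree p1 = 2 * k"
    using real_poly_even_degree_dvd[of k p] assms by (auto elim: dvdE)
  with False have "degree p = 2 * k + degree p2" by (auto simp: degree_mult_eq)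
  with p assms show ?thesis by auto
qed

text \<open>Factors of even degree can always be split off. If both degrees are odd,
  \<open>p\<close> might be a product of irreducible quadratics; a real root, given to the first
  factor, reduces this to the even case.\<close>

lemma real_poly_split:
  fixes p :: "real poly"
  assumes deg: "degree p = d + e"
    and root: "odd d \<Longrightarrow> odd e \<Longrightarrow> \<exists>a. poly p a = 0"
  shows "\<exists>p1 p2. p = p1 * p2 \<and> degree p1 = d \<and> degree p2 = e"
proof -
  consider k where "d = 2 * k" | k where "e = 2 * k" | k where "d = 2 * k + 1" "odd e"
    by (meson evenE oddE)
  then show ?thesis
  proof cases
    case 1
    then show ?thesis using real_poly_split_even[of p k e] deg by simp
  next
    case 2
    then show ?thesis using real_poly_split_even[of p k d] deg by (metis add.commute mult.commute)
  next
    case (3 k)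
    then obtain a where "poly p a = 0" using root by auto
    then obtain p' where p: "p = [:-a, 1:] * p'"
      by (auto simp: poly_eq_0_iff_dvd elim: dvdE)
    have "p' \<noteq> 0" using p deg 3 by auto
    then have "degree p = Suc (degree p')" unfolding p by (subst degree_mult_eq) auto
    then have "degree p' = 2 * k + e" using deg 3 by simp
    from real_poly_split_even[OF this] obtain p1 p2
      where s: "p' = p1 * p2" "degree p1 = 2 * k" "degree p2 = e" by blast
    have "p1 \<noteq> 0" using s \<open>p' \<noteq> 0\<close> by auto
    then have "degree ([:-a, 1:] * p1) = d" using s 3 by (subst degree_mult_eq) auto
    then show ?thesis using p s by (metis mult.assoc)
  qed
qed

text \<open>The constant \<beta> contributes order 0 and the orthogonal polynomials of degree 0 to
  \<open>d1 + d2\<close> contribute the orders 1 to \<open>d1 + d2 + 1\<close>, which allows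
  \<open>d1 + d2 + 2\<close> alternating values.\<close>

lemma alternating_melnikov_exists:
  assumes T: "T > 0" and e: "e > 0"
  shows "\<exists>p1 p2 \<beta> z s. degree p1 = d1 \<and> degree p2 = d2 \<and> (s = 1 \<or> s = -1) \<and>
     (\<forall>i\<le>Suc (d1 + d2). 0 < z i \<and> z i < e) \<and> (\<forall>i<Suc (d1 + d2). z i < z (Suc i)) \<and>
     (\<forall>i\<le>Suc (d1 + d2). 0 < s * (-1) ^ i * melnikov T \<beta> (p1 * p2) (z i))"
proof -
  let ?K = "Suc (d1 + d2)"
  obtain P where P: "\<And>k. degree (P k) = k" "\<And>k. lead_coeff (P k) = 1"
    "\<And>k q. degree q < k \<Longrightarrow> weighted_ip T (P k) q = 0"
    using orthogonal_polynomial_exists[OF T] by metis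
  define h where "h k = (case k of 0 \<Rightarrow> melnikov T 1 0 | Suc j \<Rightarrow> melnikov T 0 (P j))" for k
  define l where "l k = (case k of 0 \<Rightarrow> 2 * T | Suc j \<Rightarrow>
      ((-1/2) gchoose j) * weighted_ip T (P j) (monom 1 j))" for k
  have lim: "((\<lambda>z. h k z / z ^ k) \<longlongrightarrow> l k) (at_right 0)" for k
  proof (cases k)
    case 0
    then show ?thesis using melnikov_const_tendsto[OF T] by (simp add: h_def l_def)
  next
    case (Suc j)
    have "((\<lambda>z. melnikov T 0 (P j) z / z ^ Suc j) \<longlongrightarrow>
        ((-1/2) gchoose j) * weighted_ip T (P j) (monom 1 j)) (at_right 0)"
      by (rule melnikov_orthogonal_tendsto[OF T P(3)])
    then show ?thesis unfolding Suc h_def l_def by (simp only: nat.case)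
  qed
  have l: "l k \<noteq> 0" for k
  proof (cases k)
    case (Suc j)
    show ?thesis
      unfolding Suc l_def nat.case
      using gbinomial_minus_half_neq_0 orthogonal_polynomial_monom[OF T P(1) P(2) P(3)]
      by (metis mult_eq_0_iff)
  qed (use T in \<open>simp add: l_def\<close>)
  from alternating_combination_exists[where h = h and l = l and K = ?K, OF lim l e]
  obtain c z s where c: "c ?K = (1::real)" and s: "s = 1 \<or> s = -1"
    and z: "\<forall>i\<le>?K. 0 < z i \<and> z i < e" and mono: "\<forall>i<?K. z i < z (Suc i)"
    and alt: "\<forall>i\<le>?K. 0 < s * (-1) ^ i * (\<Sum>k\<le>?K. c k * h k (z i))"
    by (elim exE conjE) (rule that)
  define p where "p = (\<Sum>k<?K. smult (c (Suc k)) (P k))"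
  have sum: "(\<Sum>k\<le>?K. c k * h k (z i)) = melnikov T (c 0) p (z i)" if "i \<le> ?K" for i
  proof -
    have "(\<Sum>k\<le>?K. c k * h k (z i)) = c 0 * melnikov T 1 0 (z i) + (\<Sum>k<?K. c (Suc k) * melnikov T 0 (P k) (z i))"
      unfolding lessThan_Suc_atMost[symmetric] sum.lessThan_Suc_shift by (simp add: h_def)
    also have "\<dots> = melnikov T (c 0) p (z i)"
      unfolding p_def using z that by (intro melnikov_combination) (auto simp: less_imp_le)
    finally show ?thesis .
  qed
  have G: "0 < s * (-1) ^ i * melnikov T (c 0) p (z i)" if "i \<le> ?K" for i
    using alt that sum by metis
  \<comment> \<open>The degree is exact because the last coefficient is normalized to 1 and
    \<open>P (d1 + d2)\<close> is monic; an exact degree is what the splitting into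
    \<open>p1\<close> and \<open>p2\<close> asks for.\<close>
  have degp: "degree p = d1 + d2"
  proof (rule antisym)
    show "degree p \<le> d1 + d2"
      unfolding p_def by (intro degree_sum_le) (auto simp: P(1) intro: order.trans[OF degree_smult_le])
    have "coeff (\<Sum>k<d1 + d2. smult (c (Suc k)) (P k)) (d1 + d2) = 0"
      by (simp add: coeff_sum coeff_eq_0 P(1))
    then have "coeff p (d1 + d2) = 1"
      using c P(2)[of "d1 + d2"] by (simp add: p_def P(1))
    then show "d1 + d2 \<le> degree p" by (intro le_degree) simp
  qed
  \<comment> \<open>With both degrees odd there are at least three sample points, enough for the
    alternation to force a real root.\<close>
  have "\<exists>a. poly p a = 0" if odd: "odd d1" "odd d2"
  proof -
    have "2 \<le> ?K" using odd by (cases d1; cases d2) auto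
    then have "0 < z 0" "z 0 < z 1" "z 1 < z 2"
      using z mono[rule_format, of 0] mono[rule_format, of 1] odd_pos[OF odd(1)] by (simp_all add: numeral_2_eq_2)
    moreover have "0 < s * melnikov T (c 0) p (z 0)" "s * melnikov T (c 0) p (z 1) < 0"
      "0 < s * melnikov T (c 0) p (z 2)"
      using \<open>2 \<le> ?K\<close> G[of 0] G[of 1] G[of 2] by simp_all
    ultimately show ?thesis
      using s by (intro alternating_melnikov_root[OF T, of "z 0" "z 1" "z 2" s "c 0" p])
  qed
  with degp obtain p1 p2 where "p = p1 * p2" "degree p1 = d1" "degree p2 = d2"
    using real_poly_split[of p d1 d2] by blast
  with s z mono G show ?thesis by blast
qed

section \<open>Degrees, uniform bounds and the final count\<close>

lemma degree_perturbed_b: "degree (perturbed_b T p \<beta> \<epsilon>) \<le> 2 * degree p + 1"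
proof -
  have "degree ([:0, 1:] * pcompose p (weight T)) \<le> 2 * degree p + 1"
    by (rule order.trans[OF degree_mult_le]) (simp add: degree_pcompose_weight)
  then show ?thesis
    unfolding perturbed_b_def by (intro degree_add_le) auto
qed

lemma degree_pderiv_perturbed_potential:
  "degree (pderiv (perturbed_potential T p \<epsilon>)) \<le> 2 * degree p + 2"
proof -
  have w: "degree (weight T) = 2" by (simp add: weight_def)
  have "degree ([:0, 1:] * weight T * pcompose p (weight T)) \<le> 2 * degree p + 3"
    by (rule order.trans[OF degree_mult_le], rule order.trans[OF add_right_mono[OF degree_mult_le]])
      (simp add: degree_pcompose_weight w)
  then have "degree (perturbed_potential T p \<epsilon>) \<le> 2 * degree p + 3"
    unfolding perturbed_potential_def
    by (intro degree_diff_le order.trans[OF degree_smult_le]) (auto simp: w)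
  then show ?thesis by (simp add: degree_pderiv)
qed

text \<open>The bound does not involve \<open>p\<close>. This avoids a circle: \<rho> is computed
  from it, the sample points are placed below \<rho>^2, and only then is \<open>p\<close>
  known.\<close>

lemma perturbed_potential_bounded:
  "\<forall>\<^sub>F \<epsilon> in at_right 0. \<forall>t\<in>{-T..T}. \<bar>poly (pderiv (perturbed_potential T p \<epsilon>)) t\<bar> \<le> T + 1"
proof -
  define Q where "Q = pderiv ([:0, 1:] * weight T * pcompose p (weight T))"
  obtain K where K: "K > 0" "\<And>t. t \<in> {-T..T} \<Longrightarrow> \<bar>poly Q t\<bar> \<le> K"
    using poly_Icc_bounded[of "-T" T Q] by blast
  have "\<bar>poly (pderiv (perturbed_potential T p \<epsilon>)) t\<bar> \<le> T + 1"
    if "0 < \<epsilon>" "\<epsilon> < 1 / K" "t \<in> {-T..T}" for \<epsilon> t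
  proof -
    have "poly (pderiv (perturbed_potential T p \<epsilon>)) t = t - \<epsilon> * poly Q t"
      unfolding perturbed_potential_def pderiv_diff pderiv_smult Q_def[symmetric]
      by (simp add: weight_def pderiv_pCons)
    moreover have "\<bar>\<epsilon> * poly Q t\<bar> \<le> \<epsilon> * K"
      using that(1) K(2)[OF that(3)] by (simp add: abs_mult)
    moreover have "\<epsilon> * K < 1" using that(2) K(1) by (simp add: field_simps)
    ultimately show ?thesis using that(3) by auto
  qed
  moreover have "0 < 1 / K" using K(1) by simp
  ultimately show ?thesis
    unfolding eventually_at_right_field by blast
qed

lemma sgn_eq_mult_pos: "sgn a = sgn b \<Longrightarrow> 0 < c * b \<Longrightarrow> 0 < c * (a::real)"
  by (auto simp: sgn_if zero_less_mult_iff split: if_splits)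

text \<open>K zeros of the displacement on each half-line, together with the zero solution. The
  nonzero displacement at \<open>x 0\<close> supplies the point that excludes a continuum of closed
  solutions.\<close>

lemma (in picard) many_limit_cycles:
  assumes x: "\<And>i. i \<le> K \<Longrightarrow> 0 < x i \<and> x i < \<rho>" and mono: "\<And>i. i < K \<Longrightarrow> x i < x (Suc i)"
    and alt: "\<And>i \<sigma>. i \<le> K \<Longrightarrow> \<sigma> \<in> {1, -1} \<Longrightarrow> 0 < s * (-1) ^ i * (flow (\<sigma> * x i) T - \<sigma> * x i)"
  shows "enat (2 * K + 1) \<le> ecard (limit_cycles T A B)"
proof -
  define f where "f \<sigma> y = flow (\<sigma> * y) T - \<sigma> * y" for \<sigma> y
  have zeros: "\<exists>R. finite R \<and> card R = K \<and> (\<forall>r\<in>R. x 0 < r \<and> r < x K \<and> f \<sigma> r = 0)"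
    if \<sigma>: "\<sigma> \<in> {1, -1}" for \<sigma>
  proof (rule zeros_of_alternation[of x K "f \<sigma>" s])
    show "continuous_on {x 0..x K} (f \<sigma>)"
      unfolding f_def using \<sigma> x[of 0] x[of K]
      by (intro continuous_intros continuous_on_compose2[OF continuous_on_flow]) auto
  qed (use mono alt \<sigma> in \<open>auto simp: f_def\<close>)
  obtain Rp where Rp: "finite Rp" "card Rp = K" "\<And>r. r \<in> Rp \<Longrightarrow> x 0 < r \<and> r < x K \<and> f 1 r = 0"
    using zeros[of 1] by auto
  obtain Rn where Rn: "finite Rn" "card Rn = K" "\<And>r. r \<in> Rn \<Longrightarrow> x 0 < r \<and> r < x K \<and> f (-1) r = 0"
    using zeros[of "-1"] by auto
  define R where "R = insert 0 (Rp \<union> uminus ` Rn)"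
  have pos: "0 < r" "r < \<rho>" if "r \<in> Rp \<union> Rn" for r
    using that Rp(3)[of r] Rn(3)[of r] x[of 0] x[of K] by auto
  have "card (uminus ` Rn) = K"
    using Rn(2) by (simp add: card_image)
  moreover have "Rp \<inter> uminus ` Rn = {}"
  proof (rule equals0I)
    fix r assume "r \<in> Rp \<inter> uminus ` Rn"
    then obtain q where "r \<in> Rp" "q \<in> Rn" "r = - q" by blast
    with pos(1)[of r] pos(1)[of q] show False by simp
  qed
  moreover have "0 \<notin> Rp \<union> uminus ` Rn"
    using pos(1)[of 0] by auto
  ultimately have "card R = 2 * K + 1"
    using Rp Rn by (simp add: R_def card_Un_disjoint)
  moreover have "\<bar>r\<bar> < \<rho> \<and> flow r T = r" if "r \<in> R" for r
  proof -
    have "flow 0 T = 0" using flow_near[of 0 T] T_pos rho_pos by simp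
    then show ?thesis
      using that pos Rp(3) Rn(3) rho_pos by (fastforce simp: R_def f_def)
  qed
  moreover have "\<bar>x 0\<bar> < \<rho>" using x[of 0] by simp
  moreover have "flow (x 0) T \<noteq> x 0" using alt[of 0 1] by auto
  moreover have "finite R" using Rp(1) Rn(1) by (simp add: R_def)
  ultimately show ?thesis
    using card_le_limit_cycles[of R "x 0"] by simp
qed

theorem theorem5p2:
  fixes T :: real and n m :: nat
  assumes "T > 0" and "n \<ge> 2" and "m \<ge> 2"
  shows "abel_hilbert_number T n m \<ge> enat (2 * (m - m div 2 + n div 2) - 1)"
proof -
  note T = \<open>T > 0\<close>
  let ?S = "{-T..T}"
  \<comment> \<open>The largest values with \<open>2 * d1 + 1 \<le> m\<close> and
    \<open>2 * d2 + 2 \<le> n\<close>.\<close>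
  define d1 d2 where "d1 = m - m div 2 - 1" and "d2 = n div 2 - 1"
  define K where "K = Suc (d1 + d2)"
  define M where "M = T + 1"
  define \<rho> where "\<rho> = min 1 (1 / (64 * T * M))"
  have M: "0 < M" using T by (simp add: M_def)
  have \<rho>: "0 < \<rho>" "\<rho> \<le> 1" "64 * T * M * \<rho> \<le> 1"
  proof -
    show "0 < \<rho>" "\<rho> \<le> 1" using T M by (auto simp: \<rho>_def)
    have "64 * T * M * \<rho> \<le> 64 * T * M * (1 / (64 * T * M))"
      using T M by (intro mult_left_mono) (auto simp: \<rho>_def)
    then show "64 * T * M * \<rho> \<le> 1" using T M by simp
  qed
  \<comment> \<open>The bound is \<rho>^2 because \<open>z\<close> stands for the square of the
    initial value.\<close>
  from alternating_melnikov_exists[OF T zero_less_power[OF \<rho>(1), of 2], of d1 d2]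
  obtain p1 p2 \<beta> z s where p: "degree p1 = d1" "degree p2 = d2" and s: "s = 1 \<or> s = -1"
    and z': "\<forall>i\<le>K. 0 < z i \<and> z i < \<rho>\<^sup>2" and mono': "\<forall>i<K. z i < z (Suc i)"
    and G': "\<forall>i\<le>K. 0 < s * (-1) ^ i * melnikov T \<beta> (p1 * p2) (z i)"
    unfolding K_def[symmetric] by (elim exE conjE) (rule that)
  note z = z'[rule_format] and mono = mono'[rule_format] and G = G'[rule_format]
  define al where "al = perturbed_potential T p2"
  define b where "b = perturbed_b T p1 \<beta>"
  define N where "N \<epsilon> z = integral ?S (\<lambda>t. poly (b \<epsilon>) t * sqrt (1 - 2 * z * poly (al \<epsilon>) t))" for \<epsilon> z
  have "\<forall>\<^sub>F \<epsilon> in at_right 0. \<forall>i\<in>{..K}. (\<forall>t\<in>?S. 0 \<le> 1 - 2 * z i * poly (al \<epsilon>) t) \<and>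
      sgn (N \<epsilon> (z i)) = sgn (melnikov T \<beta> (p1 * p2) (z i))"
  proof (subst eventually_ball_finite_distrib, simp, intro ballI)
    fix i assume "i \<in> {..K}"
    then show "\<forall>\<^sub>F \<epsilon> in at_right 0. (\<forall>t\<in>?S. 0 \<le> 1 - 2 * z i * poly (al \<epsilon>) t) \<and>
        sgn (N \<epsilon> (z i)) = sgn (melnikov T \<beta> (p1 * p2) (z i))"
      unfolding N_def al_def b_def using z[of i] G[of i]
      by (intro first_order_melnikov_sign T) auto
  qed
  then have "\<forall>\<^sub>F \<epsilon> in at_right 0.
      (\<forall>i\<in>{..K}. (\<forall>t\<in>?S. 0 \<le> 1 - 2 * z i * poly (al \<epsilon>) t) \<and>
        sgn (N \<epsilon> (z i)) = sgn (melnikov T \<beta> (p1 * p2) (z i))) \<and>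
      (\<forall>t\<in>?S. \<bar>poly (pderiv (al \<epsilon>)) t\<bar> \<le> M)"
    unfolding al_def M_def by (intro eventually_conj perturbed_potential_bounded)
  from eventually_happens'[OF trivial_limit_at_right_real this] obtain \<epsilon>
    where ex: "\<forall>i\<in>{..K}. (\<forall>t\<in>?S. 0 \<le> 1 - 2 * z i * poly (al \<epsilon>) t) \<and>
        sgn (N \<epsilon> (z i)) = sgn (melnikov T \<beta> (p1 * p2) (z i))"
      and A_bound: "\<forall>t\<in>?S. \<bar>poly (pderiv (al \<epsilon>)) t\<bar> \<le> M"
    by (elim exE conjE) (rule that)
  have \<epsilon>: "0 \<le> 1 - 2 * z i * poly (al \<epsilon>) t" "sgn (N \<epsilon> (z i)) = sgn (melnikov T \<beta> (p1 * p2) (z i))"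
    if "i \<le> K" "t \<in> ?S" for i t
    using ex that by auto
  have ends: "poly (al \<epsilon>) (-T) = 0" "poly (al \<epsilon>) T = 0"
    by (simp_all add: al_def perturbed_potential_def poly_weight)
  have T_mem: "T \<in> ?S" using T by simp
  have NG: "0 < s * (-1) ^ i * N \<epsilon> (z i)" if "i \<le> K" for i
    using sgn_eq_mult_pos[OF \<epsilon>(2)[OF that T_mem] G[OF that]] .
  \<comment> \<open>For \<sigma> = 1 and -1 these are the two initial values over
    \<open>z i\<close>; they share the integral \<open>N\<close>, which depends on the square
    only.\<close>
  define r where "r \<sigma> i = \<sigma> * sqrt (z i)" for \<sigma> i
  define good where "good \<delta> \<sigma> i \<longleftrightarrow> (\<forall>x. abel_solution T (pderiv (al \<epsilon>)) (smult \<delta> (b \<epsilon>)) x \<and> x (-T) = r \<sigma> i \<and>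
           (\<forall>t\<in>?S. \<bar>x t - r \<sigma> i\<bar> \<le> \<bar>r \<sigma> i\<bar> / 2) \<longrightarrow> sgn (x T - r \<sigma> i) = sgn (N \<epsilon> (z i)))" for \<delta> \<sigma> i
  have good: "\<forall>\<^sub>F \<delta> in at_right 0. good \<delta> \<sigma> i" if \<sigma>: "\<sigma> \<in> {1, -1}" and i: "i \<le> K" for \<sigma> i
  proof -
    have r2: "(r \<sigma> i)\<^sup>2 = z i" using \<sigma> z[OF i] by (auto simp: r_def)
    have "r \<sigma> i \<noteq> 0" using \<sigma> z[OF i] by (auto simp: r_def)
    moreover have "N \<epsilon> (z i) \<noteq> 0" using NG[OF i] by auto
    ultimately obtain \<delta>0 where "\<delta>0 > 0" "\<And>\<delta>. 0 < \<delta> \<Longrightarrow> \<delta> \<le> \<delta>0 \<Longrightarrow> good \<delta> \<sigma> i"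
      using displacement_sign[OF T _ ends, of "r \<sigma> i" "b \<epsilon>"] \<epsilon>(1)[OF i]
      unfolding r2 N_def[symmetric] good_def by blast
    then show ?thesis unfolding eventually_at_right_field by (auto intro: less_imp_le)
  qed
  have "\<forall>\<^sub>F \<delta> in at_right 0. \<forall>\<sigma>i\<in>{1, -1} \<times> {..K}. good \<delta> (fst \<sigma>i) (snd \<sigma>i)"
    by (subst eventually_ball_finite_distrib) (auto intro: good)
  moreover have "\<forall>\<^sub>F \<delta> in at_right 0. \<forall>t\<in>?S. \<bar>poly (smult \<delta> (b \<epsilon>)) t\<bar> \<le> M"
  proof -
    obtain C where C: "C > 0" "\<And>t. t \<in> ?S \<Longrightarrow> \<bar>poly (b \<epsilon>) t\<bar> \<le> C"
      using poly_Icc_bounded[of "-T" T "b \<epsilon>"] by blast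
    have "\<bar>poly (smult \<delta> (b \<epsilon>)) t\<bar> \<le> M" if "0 < \<delta>" "\<delta> < M / C" "t \<in> ?S" for \<delta> t
    proof -
      have "\<bar>poly (smult \<delta> (b \<epsilon>)) t\<bar> \<le> \<delta> * C" using that(1) C(2)[OF that(3)] by (simp add: abs_mult)
      also have "\<dots> \<le> M" using that(2) C(1) by (simp add: field_simps)
      finally show ?thesis .
    qed
    moreover have "0 < M / C" using M C(1) by simp
    ultimately show ?thesis unfolding eventually_at_right_field by blast
  qed
  ultimately have "\<forall>\<^sub>F \<delta> in at_right 0. (\<forall>\<sigma>i\<in>{1, -1} \<times> {..K}. good \<delta> (fst \<sigma>i) (snd \<sigma>i)) \<and>
      (\<forall>t\<in>?S. \<bar>poly (smult \<delta> (b \<epsilon>)) t\<bar> \<le> M)"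
    by (rule eventually_conj)
  from eventually_happens'[OF trivial_limit_at_right_real this] obtain \<delta>
    where \<delta>: "\<forall>\<sigma>i\<in>{1, -1} \<times> {..K}. good \<delta> (fst \<sigma>i) (snd \<sigma>i)"
      and B_bound: "\<forall>t\<in>?S. \<bar>poly (smult \<delta> (b \<epsilon>)) t\<bar> \<le> M"
    by (elim exE conjE) (rule that)
  have good_\<delta>: "good \<delta> \<sigma> i" if "\<sigma> \<in> {1, -1}" "i \<le> K" for \<sigma> i
    using bspec[OF \<delta>, of "(\<sigma>, i)"] that by simp
  interpret picard T M \<rho> "pderiv (al \<epsilon>)" "smult \<delta> (b \<epsilon>)"
    by unfold_locales (rule T M \<rho> bspec[OF A_bound] bspec[OF B_bound] | assumption)+
  have "enat (2 * K + 1) \<le> ecard (limit_cycles T (pderiv (al \<epsilon>)) (smult \<delta> (b \<epsilon>)))"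
  proof (rule many_limit_cycles)
    fix i assume i: "i \<le> K"
    have "sqrt (z i) < sqrt (\<rho>\<^sup>2)" using z[OF i] by (intro real_sqrt_less_mono) simp
    then show sz: "0 < sqrt (z i) \<and> sqrt (z i) < \<rho>" using z[OF i] \<rho>(1) by simp
    fix \<sigma> :: real assume \<sigma>: "\<sigma> \<in> {1, -1}"
    have r: "\<bar>r \<sigma> i\<bar> \<le> \<rho>" using sz \<sigma> by (auto simp: r_def)
    have "sgn (flow (r \<sigma> i) T - r \<sigma> i) = sgn (N \<epsilon> (z i))"
      using good_\<delta>[OF \<sigma> i] flow_abel_solution[OF r] flow_base[OF r] flow_near[OF r]
      unfolding good_def by blast
    then show "0 < s * (-1) ^ i * (flow (\<sigma> * sqrt (z i)) T - \<sigma> * sqrt (z i))"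
      using sgn_eq_mult_pos NG[OF i] unfolding r_def by blast
  qed (use mono in simp)
  also have "\<dots> \<le> abel_hilbert_number T n m"
  proof -
    have "degree (pderiv (al \<epsilon>)) \<le> n"
      using degree_pderiv_perturbed_potential[of T p2 \<epsilon>] p(2) \<open>n \<ge> 2\<close> by (simp add: al_def d2_def)
    moreover have "degree (smult \<delta> (b \<epsilon>)) \<le> m"
      using degree_smult_le[of \<delta> "b \<epsilon>"] degree_perturbed_b[of T p1 \<beta> \<epsilon>] p(1) \<open>m \<ge> 2\<close>
      by (simp add: b_def d1_def)
    ultimately show ?thesis
      unfolding abel_hilbert_number_def
      by (intro SUP_upper2[of "(pderiv (al \<epsilon>), smult \<delta> (b \<epsilon>))"]) auto
  qed
  also have "2 * K + 1 = 2 * (m - m div 2 + n div 2) - 1"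
    using \<open>n \<ge> 2\<close> \<open>m \<ge> 2\<close> by (simp add: K_def d1_def d2_def)
  finally show ?thesis .
qed

end
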